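(* Fix $T>0$. For a closed locally convex $T$-periodic projective curve $\gamma$ with normalized lift $\Gamma$, put $F(x,y)=\Gamma(x)\cdot\Gamma^*(y)=\det(\Gamma(x),\Gamma(y),\Gamma'(y))$ and $G(x,y)=F(y,x)$. This assignment gives a one-to-one correspondence between $SL_3(\mathbb{R})$-equivalence classes of such curves and closed continuous 2-frieze patterns of period $T$. Moreover, a closed continuous 2-frieze pattern is positive if and only if the corresponding projective curve is convex.
   Context: A (closed) projective curve is a smooth $T$-periodic parametrized locally convex curve $\gamma:\mathbb{R}\to\mathbb{RP}^2$. Such curves are considered up to the action of $SL_3(\mathbb{R})$. Its lift is the unique smooth curve $\Gamma:\mathbb{R}\to\mathbb{R}^3$ projecting to $\gamma$ with $\det(\Gamma,\Gamma',\Gamma'')=1$; it is $T$-periodic. Identify $\mathbb{R}^3$ with its dual via the dot product and set $\Gamma^*(y)=\Gamma(y)\times\Gamma'(y)$. The curve $\gamma$ is convex if every line meets it at most twice, counted with multiplicity. A closed continuous 2-frieze pattern of period $T$ is a pair of smooth functions $F,G:\mathbb{R}^2\to\mathbb{R}$ satisfying the following. - $G=FF_{xy}-F_xF_y$ and $F=GG_{xy}-G_xG_y$. - For all $x$: $F(x,x)=F_x(x,x)=F_y(x,x)=0$, $F_{xx}(x,x)=F_{yy}(x,x)=1$, $F_{xy}(x,x)=-1$. - $F(x+T,y)=F(x,y+T)=F(x,y)$. - The same boundary and periodicity conditions hold for $G$. Such a pattern is positive if $F(x,y)>0$ and $G(x,y)>0$ whenever $x<y<x+T$. *)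

theory Defs
  imports "HOL-Analysis.Analysis"
begin

section \<open>Smooth maps\<close>

primrec times_differentiable_on ::
  "nat \<Rightarrow> 'a::real_normed_vector set \<Rightarrow> ('a \<Rightarrow> 'b::real_normed_vector) \<Rightarrow> bool" where
  "times_differentiable_on 0 S f \<longleftrightarrow> continuous_on S f"
| "times_differentiable_on (Suc n) S f \<longleftrightarrow>
     (\<forall>x\<in>S. f differentiable (at x)) \<and>
     (\<forall>v. times_differentiable_on n S (\<lambda>x. frechet_derivative f (at x) v))"

text \<open>Smoothness on an \<^emph>\<open>open\<close> set; the domain is always \<open>real\<close> or \<open>real \<times> real\<close> below.\<close>

definition smooth_on :: "'a::real_normed_vector set \<Rightarrow> ('a \<Rightarrow> 'b::real_normed_vector) \<Rightarrow> bool" where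
  "smooth_on S f \<longleftrightarrow> (\<forall>n. times_differentiable_on n S f)"


section \<open>Projective curves\<close>

text \<open>A point of the real projective plane is a one-dimensional subspace of \<open>real^3\<close>,
  so that a parametrized curve in it is a map \<open>real \<Rightarrow> (real^3) set\<close>.\<close>

definition proj_point :: "real^3 \<Rightarrow> (real^3) set" where
  "proj_point v = span {v}"

definition local_lift :: "real set \<Rightarrow> (real \<Rightarrow> (real^3) set) \<Rightarrow> (real \<Rightarrow> real^3) \<Rightarrow> bool" where
  "local_lift U \<gamma> c \<longleftrightarrow> open U \<and> smooth_on U c \<and> (\<forall>s\<in>U. c s \<noteq> 0 \<and> \<gamma> s = proj_point (c s))"

definition curve_deriv :: "(real \<Rightarrow> real^3) \<Rightarrow> real \<Rightarrow> real^3" where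
  "curve_deriv c t = vector_derivative c (at t)"

definition wronskian :: "(real \<Rightarrow> real^3) \<Rightarrow> real \<Rightarrow> real" where
  "wronskian c t = det (vector [c t, curve_deriv c t, curve_deriv (curve_deriv c) t] :: real^3^3)"

text \<open>A map into the projective plane is smooth iff locally it is the projection of a smooth
  map into \<open>real^3 - {0}\<close>.\<close>

definition smooth_proj_curve :: "(real \<Rightarrow> (real^3) set) \<Rightarrow> bool" where
  "smooth_proj_curve \<gamma> \<longleftrightarrow> (\<forall>t. \<exists>U c. t \<in> U \<and> local_lift U \<gamma> c)"

text \<open>Locally convex means without inflection points. The condition does not depend on the
  local lift: replacing \<open>c\<close> by \<open>f c\<close> multiplies the determinant by \<open>f\<^sup>3\<close>.\<close>

definition locally_convex :: "(real \<Rightarrow> (real^3) set) \<Rightarrow> bool" where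
  "locally_convex \<gamma> \<longleftrightarrow> (\<forall>t. \<exists>U c. t \<in> U \<and> local_lift U \<gamma> c \<and> wronskian c t \<noteq> 0)"

definition closed_projective_curves :: "real \<Rightarrow> (real \<Rightarrow> (real^3) set) set" where
  "closed_projective_curves T =
     {\<gamma>. smooth_proj_curve \<gamma> \<and> locally_convex \<gamma> \<and> (\<forall>t. \<gamma> (t + T) = \<gamma> t)}"

definition sl3_equiv :: "real \<Rightarrow> ((real \<Rightarrow> (real^3) set) \<times> (real \<Rightarrow> (real^3) set)) set" where
  "sl3_equiv T = {(\<gamma>, \<delta>). \<gamma> \<in> closed_projective_curves T \<and> \<delta> \<in> closed_projective_curves T \<and>
     (\<exists>A :: real^3^3. det A = 1 \<and> (\<forall>t. \<delta> t = (\<lambda>v. A *v v) ` \<gamma> t))}"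

lemma equiv_sl3_equiv: "equiv (closed_projective_curves T) (sl3_equiv T)"
proof (rule equivI)
  show "sl3_equiv T \<subseteq> closed_projective_curves T \<times> closed_projective_curves T"
    by (auto simp: sl3_equiv_def)
  show "refl_on (closed_projective_curves T) (sl3_equiv T)"
  proof (rule refl_onI)
    fix \<gamma> assume "\<gamma> \<in> closed_projective_curves T"
    moreover have "\<exists>A :: real^3^3. det A = 1 \<and> (\<forall>t. \<gamma> t = (\<lambda>v. A *v v) ` \<gamma> t)"
      by (intro exI[of _ "mat 1"]) (auto simp: det_I)
    ultimately show "(\<gamma>, \<gamma>) \<in> sl3_equiv T" by (simp add: sl3_equiv_def)
  qed
  show "sym (sl3_equiv T)"
  proof (rule symI)
    fix \<gamma> \<delta> assume *: "(\<gamma>, \<delta>) \<in> sl3_equiv T"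
    then obtain A :: "real^3^3" where A: "det A = 1" "\<And>t. \<delta> t = (\<lambda>v. A *v v) ` \<gamma> t"
      by (auto simp: sl3_equiv_def)
    then obtain B where B: "B ** A = mat 1"
      by (metis invertible_def invertible_det_nz zero_neq_one)
    have "det B = 1" using A B by (metis det_I det_mul mult.right_neutral)
    moreover have "\<gamma> t = (\<lambda>v. B *v v) ` \<delta> t" for t
      using B by (simp add: A image_image matrix_vector_mul_assoc)
    ultimately show "(\<delta>, \<gamma>) \<in> sl3_equiv T" using * by (auto simp: sl3_equiv_def)
  qed
  show "trans (sl3_equiv T)"
  proof (rule transI)
    fix \<gamma> \<delta> \<epsilon> assume *: "(\<gamma>, \<delta>) \<in> sl3_equiv T" "(\<delta>, \<epsilon>) \<in> sl3_equiv T"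
    then obtain A B :: "real^3^3" where A: "det A = 1" "\<And>t. \<delta> t = (\<lambda>v. A *v v) ` \<gamma> t"
      and B: "det B = 1" "\<And>t. \<epsilon> t = (\<lambda>v. B *v v) ` \<delta> t"
      by (auto simp: sl3_equiv_def)
    have "det (B ** A) = 1" "\<And>t. \<epsilon> t = (\<lambda>v. (B ** A) *v v) ` \<gamma> t"
      by (simp_all add: A B det_mul image_image matrix_vector_mul_assoc)
    then show "(\<gamma>, \<epsilon>) \<in> sl3_equiv T" using * unfolding sl3_equiv_def by blast
  qed
qed

definition is_normalized_lift :: "(real \<Rightarrow> (real^3) set) \<Rightarrow> (real \<Rightarrow> real^3) \<Rightarrow> bool" where
  "is_normalized_lift \<gamma> \<Gamma> \<longleftrightarrow> local_lift UNIV \<gamma> \<Gamma> \<and> (\<forall>t. wronskian \<Gamma> t = 1)"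

definition normalized_lift :: "(real \<Rightarrow> (real^3) set) \<Rightarrow> real \<Rightarrow> real^3" where
  "normalized_lift \<gamma> = (THE \<Gamma>. is_normalized_lift \<gamma> \<Gamma>)"

definition dual_lift :: "(real \<Rightarrow> real^3) \<Rightarrow> real \<Rightarrow> real^3" where
  "dual_lift \<Gamma> y = cross3 (\<Gamma> y) (curve_deriv \<Gamma> y)"

definition curve_F :: "(real \<Rightarrow> (real^3) set) \<Rightarrow> real \<Rightarrow> real \<Rightarrow> real" where
  "curve_F \<gamma> x y = normalized_lift \<gamma> x \<bullet> dual_lift (normalized_lift \<gamma>) y"

definition curve_G :: "(real \<Rightarrow> (real^3) set) \<Rightarrow> real \<Rightarrow> real \<Rightarrow> real" where
  "curve_G \<gamma> x y = curve_F \<gamma> y x"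

lemma curve_F_det:
  "curve_F \<gamma> x y =
     det (vector [normalized_lift \<gamma> x, normalized_lift \<gamma> y,
                  curve_deriv (normalized_lift \<gamma>) y] :: real^3^3)"
  by (simp add: curve_F_def dual_lift_def dot_cross_det)


section \<open>Convexity\<close>

definition vanishing_order :: "(real \<Rightarrow> real) \<Rightarrow> real \<Rightarrow> enat" where
  "vanishing_order f t =
     (if \<exists>n. (deriv ^^ n) f t \<noteq> 0 then enat (LEAST n. (deriv ^^ n) f t \<noteq> 0) else \<infinity>)"

text \<open>The multiplicity with which \<open>\<gamma>\<close> meets, at parameter \<open>t\<close>, the projective line
  \<open>{v. a \<bullet> v = 0}\<close>; it is \<open>0\<close> if \<open>\<gamma> t\<close> is not on the line.\<close>

definition intersection_multiplicity :: "(real \<Rightarrow> (real^3) set) \<Rightarrow> real^3 \<Rightarrow> real \<Rightarrow> enat" where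
  "intersection_multiplicity \<gamma> a t = vanishing_order (\<lambda>s. a \<bullet> normalized_lift \<gamma> s) t"

text \<open>Intersections are counted over one period. Bounding all finite partial sums bounds the
  total number of intersections, which is not assumed to be finite beforehand.\<close>

definition convex_curve :: "real \<Rightarrow> (real \<Rightarrow> (real^3) set) \<Rightarrow> bool" where
  "convex_curve T \<gamma> \<longleftrightarrow>
     (\<forall>a. a \<noteq> 0 \<longrightarrow> (\<forall>S. finite S \<and> S \<subseteq> {0..<T} \<longrightarrow>
        (\<Sum>t\<in>S. intersection_multiplicity \<gamma> a t) \<le> 2))"


section \<open>Continuous 2-friezes\<close>

definition partial_x :: "(real \<Rightarrow> real \<Rightarrow> real) \<Rightarrow> real \<Rightarrow> real \<Rightarrow> real" where
  "partial_x F x y = deriv (\<lambda>s. F s y) x"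

definition partial_y :: "(real \<Rightarrow> real \<Rightarrow> real) \<Rightarrow> real \<Rightarrow> real \<Rightarrow> real" where
  "partial_y F x y = deriv (\<lambda>s. F x s) y"

definition frieze_rule :: "(real \<Rightarrow> real \<Rightarrow> real) \<Rightarrow> (real \<Rightarrow> real \<Rightarrow> real) \<Rightarrow> bool" where
  "frieze_rule F G \<longleftrightarrow>
     (\<forall>x y. G x y = F x y * partial_y (partial_x F) x y - partial_x F x y * partial_y F x y)"

definition frieze_boundary :: "(real \<Rightarrow> real \<Rightarrow> real) \<Rightarrow> bool" where
  "frieze_boundary F \<longleftrightarrow>
     (\<forall>x. F x x = 0 \<and> partial_x F x x = 0 \<and> partial_y F x x = 0 \<and>
          partial_x (partial_x F) x x = 1 \<and> partial_y (partial_y F) x x = 1 \<and>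
          partial_y (partial_x F) x x = -1)"

definition frieze_periodic :: "real \<Rightarrow> (real \<Rightarrow> real \<Rightarrow> real) \<Rightarrow> bool" where
  "frieze_periodic T F \<longleftrightarrow> (\<forall>x y. F (x + T) y = F x y \<and> F x (y + T) = F x y)"

definition closed_friezes :: "real \<Rightarrow> ((real \<Rightarrow> real \<Rightarrow> real) \<times> (real \<Rightarrow> real \<Rightarrow> real)) set" where
  "closed_friezes T =
     {(F, G). smooth_on UNIV (\<lambda>(x, y). F x y) \<and> smooth_on UNIV (\<lambda>(x, y). G x y) \<and>
        frieze_rule F G \<and> frieze_rule G F \<and>
        frieze_boundary F \<and> frieze_boundary G \<and>
        frieze_periodic T F \<and> frieze_periodic T G}"

definition positive_frieze ::
  "real \<Rightarrow> (real \<Rightarrow> real \<Rightarrow> real) \<times> (real \<Rightarrow> real \<Rightarrow> real) \<Rightarrow> bool" where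
  "positive_frieze T P \<longleftrightarrow>
     (\<forall>x y. x < y \<and> y < x + T \<longrightarrow> fst P x y > 0 \<and> snd P x y > 0)"

end

theory Submission
  imports Defs
begin

text \<open>A local lift \<open>c\<close> becomes unimodular after multiplication by the inverse cube root of its
  Wronskian, and two unimodular lifts agree at every common parameter; hence \<open>\<Gamma>\<close> exists, is unique
  and periodic. The frieze rule for \<open>F(x,y) = \<Gamma>(x) \<bullet> \<Gamma>\<^sup>*(y)\<close> is the Lagrange identity for cross
  products. Since \<open>(F, F\<^sub>y, F\<^sub>y\<^sub>y)(x,0)\<close> is the image of \<open>\<Gamma>(x)\<close> under a constant unimodular matrix, \<open>F\<close>
  determines \<open>\<gamma>\<close> up to \<open>SL\<^sub>3\<close>.

  Conversely, given a frieze, let \<open>\<tau>\<close> be the determinant of \<open>(\<partial>\<^sub>x\<^sup>i \<partial>\<^sub>y\<^sup>j F)\<close> with \<open>i, j < 3\<close>. By the Desnanot--Jacobi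
  identity \<open>\<tau>F = F\<close>. Where \<open>\<tau> \<noteq> 1\<close> the function \<open>F\<close> vanishes on an open set, so \<open>\<tau> = 0\<close> there; thus
  \<open>\<tau>\<close> takes only the values \<open>0\<close> and \<open>1\<close>, and being \<open>1\<close> on the diagonal it is \<open>1\<close> everywhere. Consequently
  neither \<open>F\<close> nor \<open>G\<close> vanishes on a nonempty open set, which forces the coefficients of the linear
  relation \<open>F\<^sub>x\<^sub>x\<^sub>x = c\<^sub>1 F\<^sub>x + c\<^sub>0 F\<close> to be independent of \<open>y\<close>. The curve \<open>\<Gamma>(x) = (F, F\<^sub>y, F\<^sub>y\<^sub>y)(x,0)\<close>
  solves the same equation as all \<open>F(\<cdot>,y)\<close>, and the boundary conditions yield \<open>F(x,y) = \<Gamma>(x) \<bullet> \<Gamma>\<^sup>*(y)\<close>.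

  The tangent line at \<open>y\<close> meets a convex curve nowhere else, so \<open>F(\<cdot>,y)\<close> has no further zeros. If
  the frieze is positive, projection from a point of the curve is strictly monotone along the rest of
  the curve, so no three points are collinear.\<close>


section \<open>Smooth maps\<close>

unbundle cross3_syntax

text \<open>Every point of an open set has a neighbourhood on which the two maps agree, so their
  derivatives in the full space agree as well.\<close>

lemma times_differentiable_on_cong:
  assumes "open S" "\<And>x. x \<in> S \<Longrightarrow> f x = g x"
  shows "times_differentiable_on n S f \<longleftrightarrow> times_differentiable_on n S g"
  using assms(2)
proof (induction n arbitrary: f g)
  case 0
  then show ?case by (simp cong: continuous_on_cong)
next
  case (Suc n)
  have d: "f differentiable at x \<longleftrightarrow> g differentiable at x" if "x \<in> S" for x
    using Suc.prems assms(1) that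
    by (metis (no_types, lifting) differentiable_def has_derivative_transform_within_open)
  show ?case
  proof (cases "\<forall>x\<in>S. f differentiable at x")
    case True
    have "frechet_derivative f (at x) = frechet_derivative g (at x)" if "x \<in> S" for x
      using frechet_derivative_transform_within_open[of f x S g] True Suc.prems assms(1) that by blast
    then have "times_differentiable_on n S (\<lambda>x. frechet_derivative f (at x) v) =
        times_differentiable_on n S (\<lambda>x. frechet_derivative g (at x) v)" for v
      by (intro Suc.IH) auto
    then show ?thesis using d by auto
  next
    case False
    then show ?thesis using d by auto
  qed
qed

text \<open>Any explicit family \<open>D\<close> may replace the abstract
  \<open>frechet_derivative\<close>; the closure lemmas below feed it the usual derivative
  rules.\<close>

lemma times_differentiable_on_SucI:
  assumes "open S" "\<And>x. x \<in> S \<Longrightarrow> (f has_derivative D x) (at x)"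
    and "\<And>v. times_differentiable_on n S (\<lambda>x. D x v)"
  shows "times_differentiable_on (Suc n) S f"
proof -
  have "times_differentiable_on n S (\<lambda>x. frechet_derivative f (at x) v)" for v
  proof -
    have "frechet_derivative f (at x) v = D x v" if "x \<in> S" for x
      using frechet_derivative_at[OF assms(2)[OF that]] by simp
    from iffD2[OF times_differentiable_on_cong[OF assms(1) this] assms(3)] show ?thesis by simp
  qed
  then show ?thesis using assms(2) by (auto simp: differentiable_def)
qed

lemma times_differentiable_on_SucE:
  assumes "times_differentiable_on (Suc n) S f"
  obtains D where "\<And>x. x \<in> S \<Longrightarrow> (f has_derivative D x) (at x)"
    "\<And>v. times_differentiable_on n S (\<lambda>x. D x v)"
proof
  show "(f has_derivative frechet_derivative f (at x)) (at x)" if "x \<in> S" for x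
    using assms that by (simp add: frechet_derivative_works)
  show "times_differentiable_on n S (\<lambda>x. frechet_derivative f (at x) v)" for v
    using assms by simp
qed

lemma times_differentiable_on_Suc_imp:
  "times_differentiable_on (Suc n) S f \<Longrightarrow> times_differentiable_on n S f"
proof (induction n arbitrary: f)
  case 0
  then show ?case
    by (simp add: continuous_at_imp_continuous_on differentiable_imp_continuous_within)
next
  case (Suc n)
  then show ?case by (metis times_differentiable_on.simps(2))
qed

lemma times_differentiable_on_subset:
  "times_differentiable_on n S f \<Longrightarrow> U \<subseteq> S \<Longrightarrow> times_differentiable_on n U f"
  by (induction n arbitrary: f) (auto intro: continuous_on_subset)

lemma times_differentiable_on_const:
  assumes "open S"
  shows "times_differentiable_on n S (\<lambda>x. c)"
  by (induction n arbitrary: c) auto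

lemma times_differentiable_on_linear:
  assumes "open S" "bounded_linear L" "times_differentiable_on n S f"
  shows "times_differentiable_on n S (\<lambda>x. L (f x))"
  using assms(3)
proof (induction n arbitrary: f)
  case 0
  then show ?case using assms(2) by (simp add: bounded_linear.continuous_on)
next
  case (Suc n)
  obtain D where D: "\<And>x. x \<in> S \<Longrightarrow> (f has_derivative D x) (at x)"
    "\<And>v. times_differentiable_on n S (\<lambda>x. D x v)"
    using Suc.prems by (rule times_differentiable_on_SucE) blast
  show ?case
    by (rule times_differentiable_on_SucI[OF assms(1), where D="\<lambda>x v. L (D x v)"])
      (auto intro: bounded_linear.has_derivative[OF assms(2)] D Suc.IH)
qed

lemma times_differentiable_on_add:
  assumes "open S" "times_differentiable_on n S f" "times_differentiable_on n S g"
  shows "times_differentiable_on n S (\<lambda>x. f x + g x)"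
  using assms(2,3)
proof (induction n arbitrary: f g)
  case 0
  then show ?case by (simp add: continuous_on_add)
next
  case (Suc n)
  obtain D where D: "\<And>x. x \<in> S \<Longrightarrow> (f has_derivative D x) (at x)"
    "\<And>v. times_differentiable_on n S (\<lambda>x. D x v)"
    using Suc.prems(1) by (rule times_differentiable_on_SucE) blast
  obtain E where E: "\<And>x. x \<in> S \<Longrightarrow> (g has_derivative E x) (at x)"
    "\<And>v. times_differentiable_on n S (\<lambda>x. E x v)"
    using Suc.prems(2) by (rule times_differentiable_on_SucE) blast
  show ?case
    by (rule times_differentiable_on_SucI[OF assms(1), where D="\<lambda>x v. D x v + E x v"])
      (auto intro: has_derivative_add D E Suc.IH)
qed

text \<open>By the product rule the derivative is a sum of two terms of the same bilinear shape, so
  induction on \<open>n\<close> for all \<open>f\<close> and \<open>g\<close> applies.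
  Multiplication, scaling, inner and cross products are instances.\<close>

lemma times_differentiable_on_bilinear:
  assumes "open S" "bounded_bilinear B" "times_differentiable_on n S f" "times_differentiable_on n S g"
  shows "times_differentiable_on n S (\<lambda>x. B (f x) (g x))"
  using assms(3,4)
proof (induction n arbitrary: f g)
  case 0
  then show ?case using assms(2) by (simp add: bounded_bilinear.continuous_on)
next
  case (Suc n)
  obtain D where D: "\<And>x. x \<in> S \<Longrightarrow> (f has_derivative D x) (at x)"
    "\<And>v. times_differentiable_on n S (\<lambda>x. D x v)"
    using Suc.prems(1) by (rule times_differentiable_on_SucE) blast
  obtain E where E: "\<And>x. x \<in> S \<Longrightarrow> (g has_derivative E x) (at x)"
    "\<And>v. times_differentiable_on n S (\<lambda>x. E x v)"
    using Suc.prems(2) by (rule times_differentiable_on_SucE) blast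
  have "times_differentiable_on n S f" "times_differentiable_on n S g"
    using Suc.prems times_differentiable_on_Suc_imp by blast+
  then show ?case
    by (intro times_differentiable_on_SucI[OF assms(1),
          where D="\<lambda>x v. B (f x) (E x v) + B (D x v) (g x)"]
        bounded_bilinear.FDERIV[OF assms(2)] times_differentiable_on_add[OF assms(1)] Suc.IH D E)
qed

text \<open>The definition controls derivatives in fixed directions only. For a real inner function
  the chain rule can be written as a multiple of \<open>D (\<phi> x) 1\<close>, with the fixed
  direction 1, so the induction hypothesis applies.\<close>

lemma times_differentiable_on_compose_real:
  assumes "open S" "open U" "times_differentiable_on n U h" "times_differentiable_on n S \<phi>"
    and "\<phi> ` S \<subseteq> U"
  shows "times_differentiable_on n S (\<lambda>x. h (\<phi> x :: real))"
  using assms(3,4)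
proof (induction n arbitrary: h)
  case 0
  then show ?case using assms(5) by (auto intro: continuous_on_compose2)
next
  case (Suc n)
  obtain D where D: "\<And>x. x \<in> U \<Longrightarrow> (h has_derivative D x) (at x)"
    "\<And>v. times_differentiable_on n U (\<lambda>x. D x v)"
    using Suc.prems(1) by (rule times_differentiable_on_SucE) blast
  obtain E where E: "\<And>x. x \<in> S \<Longrightarrow> (\<phi> has_derivative E x) (at x)"
    "\<And>v. times_differentiable_on n S (\<lambda>x. E x v)"
    using Suc.prems(2) by (rule times_differentiable_on_SucE) blast
  have D1: "D (\<phi> x) r = r *\<^sub>R D (\<phi> x) 1" if "x \<in> S" for x r
    using linear_scale[OF has_derivative_linear[OF D(1)], of "\<phi> x" r 1] that assms(5) by auto
  show ?case
  proof (rule times_differentiable_on_SucI[OF assms(1), where D="\<lambda>x v. E x v *\<^sub>R D (\<phi> x) 1"])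
    fix x assume x: "x \<in> S"
    have "((\<lambda>x. h (\<phi> x)) has_derivative (\<lambda>v. D (\<phi> x) (E x v))) (at x)"
      using has_derivative_compose[OF E(1)[OF x] D(1)] x assms(5) by auto
    then show "((\<lambda>x. h (\<phi> x)) has_derivative (\<lambda>v. E x v *\<^sub>R D (\<phi> x) 1)) (at x)"
      by (subst D1[OF x, symmetric])
  next
    fix v
    show "times_differentiable_on n S (\<lambda>x. E x v *\<^sub>R D (\<phi> x) 1)"
      by (intro times_differentiable_on_bilinear[OF assms(1) bounded_bilinear_scaleR] E Suc.IH D
          times_differentiable_on_Suc_imp[OF Suc.prems(2)])
  qed
qed

text \<open>The direction \<open>L v\<close> in the chain rule does not depend on the point, so
  again only fixed directions occur.\<close>

lemma times_differentiable_on_compose_affine: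
  assumes "bounded_linear L" "times_differentiable_on n UNIV h"
  shows "times_differentiable_on n UNIV (\<lambda>x. h (L x + b))"
  using assms(2)
proof (induction n arbitrary: h)
  case 0
  then show ?case using bounded_linear.continuous_on[OF assms(1) continuous_on_id]
    by (auto intro!: continuous_on_compose2[of UNIV h] continuous_intros)
next
  case (Suc n)
  obtain D where D: "\<And>x. (h has_derivative D x) (at x)"
    "\<And>v. times_differentiable_on n UNIV (\<lambda>x. D x v)"
    using Suc.prems by (rule times_differentiable_on_SucE) blast
  show ?case
  proof (rule times_differentiable_on_SucI[OF open_UNIV, where D="\<lambda>x v. D (L x + b) (L v)"])
    fix x
    have "((\<lambda>x. L x + b) has_derivative L) (at x)"
      using has_derivative_add[OF bounded_linear.has_derivative[OF assms(1) has_derivative_ident]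
          has_derivative_const[of b]] by simp
    from has_derivative_compose[OF this D(1)]
    show "((\<lambda>x. h (L x + b)) has_derivative (\<lambda>v. D (L x + b) (L v))) (at x)" .
  qed (auto intro: Suc.IH D)
qed

lemma times_differentiable_on_ident:
  assumes "open S"
  shows "times_differentiable_on n S (\<lambda>x. x)"
proof (cases n)
  case (Suc m)
  show ?thesis unfolding Suc
    by (rule times_differentiable_on_SucI[OF assms has_derivative_ident times_differentiable_on_const[OF assms]])
qed simp

text \<open>The derivative is a polynomial in \<open>inverse x\<close>, so each order of
  differentiability yields the next. The cube root below is treated in the same way.\<close>

lemma times_differentiable_on_inverse:
  "times_differentiable_on n (- {0::real}) inverse"
proof (induction n)
  case 0
  then show ?case by (auto intro!: continuous_intros)
next
  case (Suc n)
  have o: "open (- {0::real})" by auto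
  have "times_differentiable_on n (-{0::real}) (\<lambda>x. - (inverse x * inverse x * v))" for v
    by (intro times_differentiable_on_linear[OF o bounded_linear_minus[OF bounded_linear_ident]]
        times_differentiable_on_bilinear[OF o bounded_bilinear_mult] Suc times_differentiable_on_const[OF o])
  moreover have "(inverse has_derivative (\<lambda>v. - (inverse x * inverse x * v))) (at x)"
    if "x \<in> - {0::real}" for x
  proof -
    have "x \<noteq> 0" using that by simp
    from DERIV_inverse[OF this, of UNIV]
    have "(inverse has_derivative (*) (- (inverse x * inverse x))) (at x)"
      by (simp add: has_field_derivative_def power2_eq_square)
    moreover have "(*) (- (inverse x * inverse x)) = (\<lambda>v. - (inverse x * inverse x * v))"
      by (simp add: fun_eq_iff)
    ultimately show ?thesis by simp
  qed
  ultimately show ?case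
    by (intro times_differentiable_on_SucI[OF o, where D="\<lambda>x v. - (inverse x * inverse x * v)"])
qed

lemma times_differentiable_on_root3:
  "times_differentiable_on n (- {0::real}) (root 3)"
proof (induction n)
  case 0
  then show ?case by (auto intro!: continuous_intros)
next
  case (Suc n)
  have o: "open (- {0::real})" by auto
  let ?D = "\<lambda>x v. v * inverse (3 * (root 3 x * root 3 x))"
  have "times_differentiable_on n (-{0::real}) (\<lambda>x. ?D x v)" for v
    by (intro times_differentiable_on_compose_real[OF o o times_differentiable_on_inverse]
        times_differentiable_on_bilinear[OF o bounded_bilinear_mult] Suc times_differentiable_on_const[OF o])
      auto
  moreover have "(root 3 has_derivative ?D x) (at x)" if "x \<in> - {0::real}" for x
  proof -
    have "(root 3 has_field_derivative inverse (3 * (root 3 x * root 3 x))) (at x)"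
      by (rule DERIV_real_root_generic) (use that in \<open>auto simp: power2_eq_square\<close>)
    moreover have "(*) (inverse (3 * (root 3 x * root 3 x))) = ?D x"
      by (simp add: fun_eq_iff)
    ultimately show ?thesis by (simp add: has_field_derivative_def)
  qed
  ultimately show ?case
    by (intro times_differentiable_on_SucI[OF o, where D="?D"])
qed

section \<open>Closure properties of smoothness\<close>

lemma smooth_on_cong:
  "open S \<Longrightarrow> (\<And>x. x \<in> S \<Longrightarrow> f x = g x) \<Longrightarrow> smooth_on S f \<longleftrightarrow> smooth_on S g"
  unfolding smooth_on_def using times_differentiable_on_cong by blast

lemma smooth_on_subset: "smooth_on S f \<Longrightarrow> U \<subseteq> S \<Longrightarrow> smooth_on U f"
  unfolding smooth_on_def using times_differentiable_on_subset by blast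

lemma smooth_on_const: "open S \<Longrightarrow> smooth_on S (\<lambda>x. c)"
  by (simp add: smooth_on_def times_differentiable_on_const)

lemma smooth_on_ident: "open S \<Longrightarrow> smooth_on S (\<lambda>x. x)"
  by (simp add: smooth_on_def times_differentiable_on_ident)

lemma smooth_on_linear:
  "open S \<Longrightarrow> bounded_linear L \<Longrightarrow> smooth_on S f \<Longrightarrow> smooth_on S (\<lambda>x. L (f x))"
  by (simp add: smooth_on_def times_differentiable_on_linear)

lemma smooth_on_add:
  "open S \<Longrightarrow> smooth_on S f \<Longrightarrow> smooth_on S g \<Longrightarrow> smooth_on S (\<lambda>x. f x + g x)"
  by (simp add: smooth_on_def times_differentiable_on_add)

lemma smooth_on_bilinear:
  "open S \<Longrightarrow> bounded_bilinear B \<Longrightarrow> smooth_on S f \<Longrightarrow> smooth_on S g \<Longrightarrow>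
    smooth_on S (\<lambda>x. B (f x) (g x))"
  by (simp add: smooth_on_def times_differentiable_on_bilinear)

lemmas smooth_on_mult = smooth_on_bilinear[OF _ bounded_bilinear_mult]
lemmas smooth_on_scaleR = smooth_on_bilinear[OF _ bounded_bilinear_scaleR]
lemmas smooth_on_inner = smooth_on_bilinear[OF _ bounded_bilinear_inner]

lemma bounded_bilinear_cross3: "bounded_bilinear (\<times>)"
  using bilinear_cross bilinear_conv_bounded_bilinear by blast

lemmas smooth_on_cross3 = smooth_on_bilinear[OF _ bounded_bilinear_cross3]

lemma smooth_on_compose_real:
  "open S \<Longrightarrow> open U \<Longrightarrow> smooth_on U h \<Longrightarrow> smooth_on S \<phi> \<Longrightarrow> \<phi> ` S \<subseteq> U \<Longrightarrow>
    smooth_on S (\<lambda>x. h (\<phi> x :: real))"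
  by (simp add: smooth_on_def times_differentiable_on_compose_real)

lemma smooth_on_compose_affine:
  "bounded_linear L \<Longrightarrow> smooth_on UNIV h \<Longrightarrow> smooth_on UNIV (\<lambda>x. h (L x + b))"
  by (simp add: smooth_on_def times_differentiable_on_compose_affine)

lemma smooth_on_inverse:
  assumes "open S" "smooth_on S \<phi>" "\<And>x. x \<in> S \<Longrightarrow> \<phi> x \<noteq> (0::real)"
  shows "smooth_on S (\<lambda>x. inverse (\<phi> x))"
  by (rule smooth_on_compose_real[where U="-{0}"])
    (use assms in \<open>auto simp: smooth_on_def times_differentiable_on_inverse\<close>)

lemma smooth_on_root3:
  assumes "open S" "smooth_on S \<phi>" "\<And>x. x \<in> S \<Longrightarrow> \<phi> x \<noteq> (0::real)"
  shows "smooth_on S (\<lambda>x. root 3 (\<phi> x))"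
  by (rule smooth_on_compose_real[where U="-{0}"])
    (use assms in \<open>auto simp: smooth_on_def times_differentiable_on_root3\<close>)

lemma times_differentiable_on_local:
  assumes "\<And>x. x \<in> S \<Longrightarrow> \<exists>U. open U \<and> x \<in> U \<and> times_differentiable_on n U f"
  shows "times_differentiable_on n S f"
  using assms
proof (induction n arbitrary: f)
  case 0
  then show ?case
    by (metis continuous_at_imp_continuous_on continuous_on_eq_continuous_at times_differentiable_on.simps(1))
next
  case (Suc n)
  have "f differentiable at x" if "x \<in> S" for x
    using Suc.prems[OF that] by auto
  moreover have "times_differentiable_on n S (\<lambda>x. frechet_derivative f (at x) v)" for v
    by (rule Suc.IH) (use Suc.prems in \<open>fastforce\<close>)
  ultimately show ?case by simp
qed

lemma smooth_on_local:
  assumes "\<And>x. x \<in> S \<Longrightarrow> \<exists>U. open U \<and> x \<in> U \<and> smooth_on U f"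
  shows "smooth_on S f"
  unfolding smooth_on_def
proof
  fix n show "times_differentiable_on n S f"
    by (rule times_differentiable_on_local) (use assms in \<open>auto simp: smooth_on_def\<close>)
qed

lemma smooth_on_frechet_derivative:
  assumes "smooth_on S f"
  shows "smooth_on S (\<lambda>x. frechet_derivative f (at x) v)"
  unfolding smooth_on_def
proof
  fix n
  have "times_differentiable_on (Suc n) S f" using assms unfolding smooth_on_def ..
  then show "times_differentiable_on n S (\<lambda>x. frechet_derivative f (at x) v)" by simp
qed

lemma smooth_on_has_derivative:
  assumes "smooth_on S f" "x \<in> S"
  shows "(f has_derivative frechet_derivative f (at x)) (at x)"
proof -
  have "times_differentiable_on (Suc 0) S f" using assms(1) unfolding smooth_on_def ..
  then show ?thesis using assms(2) by (simp add: frechet_derivative_works)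
qed

lemma smooth_on_continuous_on: "smooth_on S f \<Longrightarrow> continuous_on S f"
  unfolding smooth_on_def by (metis times_differentiable_on.simps(1))

lemma smooth_on_has_vector_derivative:
  assumes "smooth_on S f" "x \<in> S"
  shows "(f has_vector_derivative vector_derivative f (at x)) (at x)"
  using smooth_on_has_derivative[OF assms] vector_derivative_works differentiable_def by blast

lemma smooth_on_vector_derivative:
  assumes "open S" "smooth_on S f"
  shows "smooth_on S (\<lambda>x. vector_derivative f (at x))"
proof -
  have "vector_derivative f (at x) = frechet_derivative f (at x) 1" if "x \<in> S" for x
    using frechet_derivative_eq_vector_derivative smooth_on_has_derivative[OF assms(2) that]
    by (metis differentiableI scaleR_one)
  from iffD2[OF smooth_on_cong[OF assms(1) this] smooth_on_frechet_derivative[OF assms(2)]]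
  show ?thesis by simp
qed


section \<open>Smooth functions of two variables\<close>

abbreviation smooth2 :: "(real \<Rightarrow> real \<Rightarrow> real) \<Rightarrow> bool" where
  "smooth2 F \<equiv> smooth_on UNIV (\<lambda>(x, y). F x y)"

text \<open>The partial derivative is the Frechet derivative in direction (1, 0), hence it is smooth
  again.\<close>

lemma smooth2_partial_x:
  assumes "smooth2 F"
  shows "((\<lambda>s. F s y) has_real_derivative partial_x F x y) (at x)" and "smooth2 (partial_x F)"
proof -
  let ?f = "\<lambda>(x, y). F x y"
  have D: "((\<lambda>s. F s y) has_real_derivative frechet_derivative ?f (at (x, y)) (1, 0)) (at x)" for x y
  proof -
    have "(?f has_derivative frechet_derivative ?f (at (x, y))) (at (x, y))"
      using smooth_on_has_derivative[OF assms] by simp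
    moreover have "((\<lambda>s. (s, y)) has_derivative (\<lambda>h. (h, 0))) (at x)"
      by (intro derivative_eq_intros) auto
    ultimately have "((\<lambda>s. ?f (s, y)) has_derivative
        (\<lambda>h. frechet_derivative ?f (at (x, y)) (h, 0))) (at x)"
      using has_derivative_compose[of "\<lambda>s. (s, y)"] by blast
    then have h: "((\<lambda>s. F s y) has_derivative
        (\<lambda>h. frechet_derivative ?f (at (x, y)) (h, 0))) (at x)" by simp
    have "frechet_derivative ?f (at (x, y)) (h, 0) = frechet_derivative ?f (at (x, y)) (1, 0) * h" for h
      using linear_scale[OF has_derivative_linear[OF h], of h 1] by simp
    then have "(\<lambda>h. frechet_derivative ?f (at (x, y)) (h, 0)) = (*) (frechet_derivative ?f (at (x, y)) (1, 0))"
      by (rule ext)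
    with h show ?thesis unfolding has_field_derivative_def by (simp only:)
  qed
  then have e: "partial_x F x y = frechet_derivative ?f (at (x, y)) (1, 0)" for x y
    unfolding partial_x_def by (rule DERIV_imp_deriv)
  show "((\<lambda>s. F s y) has_real_derivative partial_x F x y) (at x)" using D e by simp
  show "smooth2 (partial_x F)"
    using smooth_on_frechet_derivative[OF assms, of "(1, 0)"] by (simp add: e case_prod_unfold)
qed

lemma smooth2_swap:
  assumes "smooth2 F"
  shows "smooth2 (\<lambda>y x. F x y)"
proof -
  have "bounded_linear (\<lambda>p::real \<times> real. (snd p, fst p))"
    by (intro bounded_linear_intros)
  from smooth_on_compose_affine[OF this assms, of 0] show ?thesis
    by (simp add: case_prod_unfold)
qed

lemma partial_x_swap: "partial_x (\<lambda>y x. F x y) y x = partial_y F x y"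
  and partial_y_swap: "partial_y (\<lambda>y x. F x y) y x = partial_x F x y"
  by (simp_all add: partial_x_def partial_y_def)

lemma smooth2_partial_y:
  assumes "smooth2 F"
  shows "((\<lambda>s. F x s) has_real_derivative partial_y F x y) (at y)" and "smooth2 (partial_y F)"
proof -
  note p = smooth2_partial_x[OF smooth2_swap[OF assms]]
  show "((\<lambda>s. F x s) has_real_derivative partial_y F x y) (at y)"
    using p(1)[of x y] by (simp add: partial_x_swap)
  have "partial_x (\<lambda>y x. F x y) = (\<lambda>y x. partial_y F x y)"
    by (intro ext) (rule partial_x_swap)
  then show "smooth2 (partial_y F)" using smooth2_swap[OF p(2)] by simp
qed

section \<open>Symmetry of the mixed second partials\<close>

lemma smooth2_double_difference:
  assumes "smooth2 F" "h > 0"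
  shows "\<exists>\<xi> \<eta>. x < \<xi> \<and> \<xi> < x + h \<and> y < \<eta> \<and> \<eta> < y + h \<and>
    F (x + h) (y + h) - F x (y + h) - F (x + h) y + F x y = h * h * partial_y (partial_x F) \<xi> \<eta>"
proof -
  \<comment> \<open>Mean value theorem in \<open>x\<close> for the difference of two horizontal
    slices, then once more in \<open>y\<close>.\<close>
  have "\<exists>\<xi>. x < \<xi> \<and> \<xi> < x + h \<and> (F (x + h) (y + h) - F (x + h) y) - (F x (y + h) - F x y) =
      (x + h - x) * (partial_x F \<xi> (y + h) - partial_x F \<xi> y)"
    by (rule MVT2[where f="\<lambda>s. F s (y + h) - F s y"])
      (use assms in \<open>auto intro!: DERIV_diff smooth2_partial_x(1)\<close>)
  then obtain \<xi> where \<xi>: "x < \<xi>" "\<xi> < x + h"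
    "(F (x + h) (y + h) - F (x + h) y) - (F x (y + h) - F x y) =
      h * (partial_x F \<xi> (y + h) - partial_x F \<xi> y)" by auto
  have "\<exists>\<eta>. y < \<eta> \<and> \<eta> < y + h \<and> partial_x F \<xi> (y + h) - partial_x F \<xi> y =
      (y + h - y) * partial_y (partial_x F) \<xi> \<eta>"
    by (rule MVT2) (use assms in \<open>auto intro!: smooth2_partial_y(1) smooth2_partial_x(2)\<close>)
  then obtain \<eta> where "y < \<eta>" "\<eta> < y + h"
    "partial_x F \<xi> (y + h) - partial_x F \<xi> y = h * partial_y (partial_x F) \<xi> \<eta>" by auto
  with \<xi> show ?thesis by (intro exI[of _ \<xi>] exI[of _ \<eta>]) simp
qed

lemma smooth2_tendsto:
  assumes "smooth2 F" "a \<longlonglongrightarrow> x" "b \<longlonglongrightarrow> y"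
  shows "(\<lambda>n. F (a n) (b n)) \<longlonglongrightarrow> F x y"
proof -
  have "isCont (\<lambda>(x, y). F x y) (x, y)"
    using smooth_on_continuous_on[OF assms(1)] by (simp add: continuous_on_eq_continuous_at)
  from isCont_tendsto_compose[OF this tendsto_Pair[OF assms(2,3)]] show ?thesis by simp
qed

lemma tendsto_of_squeeze_inverse:
  fixes x :: real
  assumes "\<And>n. x < a n" "\<And>n. a n < x + inverse (real (Suc n))"
  shows "a \<longlonglongrightarrow> x"
proof (rule real_tendsto_sandwich)
  show "(\<lambda>n. x) \<longlonglongrightarrow> x" by simp
  show "(\<lambda>n. x + inverse (real (Suc n))) \<longlonglongrightarrow> x"
    using tendsto_add[OF tendsto_const LIMSEQ_inverse_real_of_nat, of x] by simp
qed (use assms less_imp_le in \<open>auto intro!: always_eventually\<close>)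

text \<open>One double difference over a square of side \<open>h\<close> equals \<open>h * h\<close>
  times either mixed partial at some point of the square. Letting \<open>h\<close> tend to 0,
  continuity identifies the two at the corner.\<close>

lemma partial_commute:
  assumes "smooth2 F"
  shows "partial_x (partial_y F) = partial_y (partial_x F)"
proof (intro ext)
  fix x y
  let ?h = "\<lambda>n. inverse (real (Suc n))" and ?S = "\<lambda>y x. F x y"
  have sw: "partial_y (partial_x ?S) = (\<lambda>y x. partial_x (partial_y F) x y)"
    by (intro ext) (simp add: partial_x_def partial_y_def)
  define Q where "Q = (\<lambda>n \<xi> \<eta> \<xi>' \<eta>'. (x < \<xi> \<and> \<xi> < x + ?h n \<and> y < \<eta> \<and> \<eta> < y + ?h n) \<and>
     (x < \<xi>' \<and> \<xi>' < x + ?h n \<and> y < \<eta>' \<and> \<eta>' < y + ?h n) \<and>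
     partial_y (partial_x F) \<xi> \<eta> = partial_x (partial_y F) \<xi>' \<eta>')"
  have "\<exists>\<xi> \<eta> \<xi>' \<eta>'. Q n \<xi> \<eta> \<xi>' \<eta>'" for n
  proof -
    have h: "?h n > 0" by simp
    obtain \<xi> \<eta> where 1: "x < \<xi> \<and> \<xi> < x + ?h n \<and> y < \<eta> \<and> \<eta> < y + ?h n"
      "F (x + ?h n) (y + ?h n) - F x (y + ?h n) - F (x + ?h n) y + F x y =
         ?h n * ?h n * partial_y (partial_x F) \<xi> \<eta>"
      using smooth2_double_difference[OF assms h, of x y] by blast
    \<comment> \<open>Exchanging the variables represents the same double difference by the other
      mixed partial.\<close>
    obtain \<eta>' \<xi>' where 2: "y < \<eta>' \<and> \<eta>' < y + ?h n \<and> x < \<xi>' \<and> \<xi>' < x + ?h n"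
      "F (x + ?h n) (y + ?h n) - F (x + ?h n) y - F x (y + ?h n) + F x y =
         ?h n * ?h n * partial_x (partial_y F) \<xi>' \<eta>'"
      using smooth2_double_difference[OF smooth2_swap[OF assms] h, of y x] unfolding sw by blast
    have "?h n * ?h n * partial_y (partial_x F) \<xi> \<eta> = ?h n * ?h n * partial_x (partial_y F) \<xi>' \<eta>'"
      using 1(2) 2(2) by linarith
    then have "partial_y (partial_x F) \<xi> \<eta> = partial_x (partial_y F) \<xi>' \<eta>'"
      using h by simp
    with 1(1) 2(1) show ?thesis unfolding Q_def by blast
  qed
  then have "\<forall>n. \<exists>\<xi> \<eta> \<xi>' \<eta>'. Q n \<xi> \<eta> \<xi>' \<eta>'" ..
  from choice[OF this] obtain \<xi> where "\<forall>n. \<exists>\<eta> \<xi>' \<eta>'. Q n (\<xi> n) \<eta> \<xi>' \<eta>'" ..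
  from choice[OF this] obtain \<eta> where "\<forall>n. \<exists>\<xi>' \<eta>'. Q n (\<xi> n) (\<eta> n) \<xi>' \<eta>'" ..
  from choice[OF this] obtain \<xi>' where "\<forall>n. \<exists>\<eta>'. Q n (\<xi> n) (\<eta> n) (\<xi>' n) \<eta>'" ..
  from choice[OF this] obtain \<eta>' where "\<forall>n. Q n (\<xi> n) (\<eta> n) (\<xi>' n) (\<eta>' n)" ..
  then have p: "x < \<xi> n" "\<xi> n < x + ?h n" "y < \<eta> n" "\<eta> n < y + ?h n"
      "x < \<xi>' n" "\<xi>' n < x + ?h n" "y < \<eta>' n" "\<eta>' n < y + ?h n"
      "partial_y (partial_x F) (\<xi> n) (\<eta> n) = partial_x (partial_y F) (\<xi>' n) (\<eta>' n)" for n
    unfolding Q_def by auto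
  have "(\<lambda>n. partial_y (partial_x F) (\<xi> n) (\<eta> n)) \<longlonglongrightarrow> partial_y (partial_x F) x y"
    by (rule smooth2_tendsto[OF smooth2_partial_y(2)[OF smooth2_partial_x(2)[OF assms]]
          tendsto_of_squeeze_inverse[OF p(1,2)] tendsto_of_squeeze_inverse[OF p(3,4)]])
  moreover have "(\<lambda>n. partial_x (partial_y F) (\<xi>' n) (\<eta>' n)) \<longlonglongrightarrow> partial_x (partial_y F) x y"
    by (rule smooth2_tendsto[OF smooth2_partial_x(2)[OF smooth2_partial_y(2)[OF assms]]
          tendsto_of_squeeze_inverse[OF p(5,6)] tendsto_of_squeeze_inverse[OF p(7,8)]])
  ultimately show "partial_x (partial_y F) x y = partial_y (partial_x F) x y"
    using LIMSEQ_unique p(9) by simp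
qed


section \<open>Normalized lifts\<close>

lemma smooth_on_curve_deriv:
  assumes "open U" "smooth_on U c"
  shows "smooth_on U (curve_deriv c)"
  using smooth_on_vector_derivative[OF assms] by (simp add: curve_deriv_def[abs_def])

lemma has_vector_derivative_curve_deriv:
  assumes "smooth_on U c" "t \<in> U"
  shows "(c has_vector_derivative curve_deriv c t) (at t)"
  using smooth_on_has_vector_derivative[OF assms] by (simp add: curve_deriv_def)

lemma curve_deriv_eqI: "(c has_vector_derivative v) (at t) \<Longrightarrow> curve_deriv c t = v"
  by (simp add: curve_deriv_def vector_derivative_at)

lemma curve_deriv_cong:
  assumes "open U" "smooth_on U c" "\<And>s. s \<in> U \<Longrightarrow> c s = d s" "t \<in> U"
  shows "curve_deriv c t = curve_deriv d t"
proof -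
  have "(d has_vector_derivative curve_deriv c t) (at t)"
    by (rule has_vector_derivative_transform_within_open[OF has_vector_derivative_curve_deriv])
      (use assms in auto)
  then show ?thesis by (simp add: curve_deriv_eqI)
qed

lemma wronskian_eq:
  "wronskian c t = c t \<bullet> (curve_deriv c t \<times> curve_deriv (curve_deriv c) t)"
  by (simp add: wronskian_def dot_cross_det)

lemma wronskian_cong:
  assumes "open U" "smooth_on U c" "\<And>s. s \<in> U \<Longrightarrow> c s = d s" "t \<in> U"
  shows "wronskian c t = wronskian d t"
proof -
  have "curve_deriv c s = curve_deriv d s" if "s \<in> U" for s
    using curve_deriv_cong assms(1-3) that by blast
  moreover from this have "curve_deriv (curve_deriv c) t = curve_deriv (curve_deriv d) t"
    using curve_deriv_cong[OF assms(1) smooth_on_curve_deriv[OF assms(1,2)]] assms(4) by blast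
  ultimately show ?thesis using assms(3,4) by (simp add: wronskian_eq)
qed

lemma smooth_on_wronskian:
  assumes "open U" "smooth_on U c"
  shows "smooth_on U (wronskian c)"
  unfolding wronskian_eq[abs_def]
  by (intro smooth_on_inner smooth_on_cross3 smooth_on_curve_deriv assms)

text \<open>The three vectors arise from \<open>u\<close>, \<open>v\<close>, \<open>w\<close> by a
  triangular matrix with diagonal entry \<open>a\<close> throughout, whence the cube. The first two
  derivatives of a rescaled curve have this shape.\<close>

lemma triple_product_scale:
  fixes u v w :: "real^3"
  shows "(a *\<^sub>R u) \<bullet> ((b *\<^sub>R u + a *\<^sub>R v) \<times> (c *\<^sub>R u + d *\<^sub>R v + a *\<^sub>R w)) = a ^ 3 * (u \<bullet> (v \<times> w))"
  by (simp add: cross_add_left cross_add_right cross_mult_left cross_mult_right inner_add_right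
      dot_cross_self power3_eq_cube)

lemma wronskian_scale:
  assumes U: "open U" and f: "smooth_on U f" and c: "smooth_on U c" and t: "t \<in> U"
  shows "wronskian (\<lambda>s. f s *\<^sub>R c s) t = f t ^ 3 * wronskian c t"
proof -
  let ?f' = "\<lambda>s. vector_derivative f (at s)" and ?c' = "curve_deriv c"
  let ?f'' = "\<lambda>s. vector_derivative ?f' (at s)" and ?c'' = "curve_deriv ?c'"
  have f': "smooth_on U ?f'" and c': "smooth_on U ?c'"
    by (intro smooth_on_vector_derivative smooth_on_curve_deriv U f c)+
  note ders = smooth_on_has_vector_derivative[OF f] smooth_on_has_vector_derivative[OF f']
    has_vector_derivative_curve_deriv[OF c] has_vector_derivative_curve_deriv[OF c']
  note scale = bounded_bilinear.has_vector_derivative[OF bounded_bilinear_scaleR]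
  have 1: "curve_deriv (\<lambda>s. f s *\<^sub>R c s) s = ?f' s *\<^sub>R c s + f s *\<^sub>R ?c' s" if "s \<in> U" for s
    by (rule curve_deriv_eqI) (use scale[OF ders(1,3)[OF that]] in \<open>simp add: add.commute\<close>)
  have "curve_deriv (curve_deriv (\<lambda>s. f s *\<^sub>R c s)) t = curve_deriv (\<lambda>s. ?f' s *\<^sub>R c s + f s *\<^sub>R ?c' s) t"
    by (rule curve_deriv_cong[OF U _ 1 t])
      (intro smooth_on_curve_deriv smooth_on_scaleR U f c)
  also have "\<dots> = (?f' t *\<^sub>R ?c' t + ?f'' t *\<^sub>R c t) + (f t *\<^sub>R ?c'' t + ?f' t *\<^sub>R ?c' t)"
    by (intro curve_deriv_eqI has_vector_derivative_add scale ders t)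
  also have "\<dots> = ?f'' t *\<^sub>R c t + (2 * ?f' t) *\<^sub>R ?c' t + f t *\<^sub>R ?c'' t"
    by (simp only: mult_2 scaleR_add_left ac_simps)
  finally show ?thesis
    by (simp only: wronskian_eq 1[OF t] triple_product_scale)
qed

section \<open>Existence, uniqueness and periodicity of the unimodular lift\<close>

lemma proj_point_eq_imp_scale:
  assumes "proj_point v = proj_point w" "v \<noteq> 0"
  shows "w = ((w \<bullet> v) * inverse (v \<bullet> v)) *\<^sub>R v"
proof -
  have "w \<in> span {v}" using assms(1) span_base[of w "{w}"] by (simp add: proj_point_def)
  then obtain k where "w = k *\<^sub>R v" by (auto simp: span_singleton)
  then show ?thesis using assms(2) by simp
qed

lemma normalized_local_lift_unique:
  assumes c: "local_lift U \<gamma> c" "\<And>s. s \<in> U \<Longrightarrow> wronskian c s = 1"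
    and d: "local_lift V \<gamma> d" "\<And>s. s \<in> V \<Longrightarrow> wronskian d s = 1"
    and t: "t \<in> U" "t \<in> V"
  shows "c t = d t"
proof -
  \<comment> \<open>Writing the ratio of the two lifts by inner products makes its smoothness
    visible, as the scaling rule for Wronskians requires.\<close>
  let ?I = "U \<inter> V" and ?f = "\<lambda>s. (d s \<bullet> c s) * inverse (c s \<bullet> c s)"
  have I: "open ?I" using c d by (auto simp: local_lift_def)
  have sc: "smooth_on ?I c" and sd: "smooth_on ?I d"
    using c(1) d(1) by (auto simp: local_lift_def intro: smooth_on_subset)
  have eq: "d s = ?f s *\<^sub>R c s" if "s \<in> ?I" for s
    by (rule proj_point_eq_imp_scale) (use c d that in \<open>auto simp: local_lift_def\<close>)
  have f: "smooth_on ?I ?f"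
    by (intro smooth_on_mult smooth_on_inverse smooth_on_inner I sc sd)
      (use c in \<open>auto simp: local_lift_def\<close>)
  have "wronskian d t = wronskian (\<lambda>s. ?f s *\<^sub>R c s) t"
    by (rule wronskian_cong[OF I sd eq]) (use t in auto)
  also have "\<dots> = ?f t ^ 3 * wronskian c t"
    by (rule wronskian_scale[OF I f sc]) (use t in auto)
  finally have "?f t ^ 3 = 1 ^ 3" using c(2) d(2) t by simp
  \<comment> \<open>The only real cube root of 1 is 1.\<close>
  then have "?f t = 1" by (metis odd_real_root_power_cancel odd_numeral)
  then show ?thesis using eq[of t] t by simp
qed

lemma normalized_local_lift_exists:
  assumes "t \<in> U" "local_lift U \<gamma> c" "wronskian c t \<noteq> 0"
  shows "\<exists>V d. t \<in> V \<and> local_lift V \<gamma> d \<and> (\<forall>s\<in>V. wronskian d s = 1)"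
proof -
  have U: "open U" and sc: "smooth_on U c" using assms(2) by (auto simp: local_lift_def)
  \<comment> \<open>On this open neighbourhood of \<open>t\<close> the cube root of the Wronskian is
    smooth and invertible; the root being odd, either sign of the Wronskian is allowed.\<close>
  define V where "V = {s \<in> U. wronskian c s \<noteq> 0}"
  have "V = U \<inter> wronskian c -` (- {0})" by (auto simp: V_def)
  moreover have "open (U \<inter> wronskian c -` (- {0}))"
    by (rule continuous_open_preimage[OF smooth_on_continuous_on[OF smooth_on_wronskian[OF U sc]] U]) auto
  ultimately have V: "open V" by simp
  have VU: "V \<subseteq> U" by (auto simp: V_def)
  have nz: "wronskian c s \<noteq> 0" if "s \<in> V" for s using that by (simp add: V_def)
  let ?f = "\<lambda>s. inverse (root 3 (wronskian c s))"
  have sV: "smooth_on V c" by (rule smooth_on_subset[OF sc VU])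
  have f: "smooth_on V ?f"
    by (intro smooth_on_inverse smooth_on_root3 smooth_on_wronskian V sV) (simp_all add: nz)
  have "proj_point (?f s *\<^sub>R c s) = proj_point (c s)" if "s \<in> V" for s
    unfolding proj_point_def
    using nz[OF that] by (intro span_image_scale[of "{c s}" "\<lambda>_. ?f s", simplified])
  moreover have "c s \<noteq> 0" "\<gamma> s = proj_point (c s)" if "s \<in> V" for s
    using assms(2) VU that by (auto simp: local_lift_def)
  ultimately have "local_lift V \<gamma> (\<lambda>s. ?f s *\<^sub>R c s)"
    using nz V f sV by (auto simp: local_lift_def intro!: smooth_on_scaleR)
  moreover have "wronskian (\<lambda>s. ?f s *\<^sub>R c s) s = 1" if "s \<in> V" for s
    using wronskian_scale[OF V f sV that] nz[OF that] odd_real_root_pow[of 3 "wronskian c s"]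
    by (simp add: power_inverse)
  moreover have "t \<in> V" using assms by (simp add: V_def)
  ultimately show ?thesis by blast
qed

lemma normalized_lift_eqI:
  assumes "is_normalized_lift \<gamma> \<Gamma>"
  shows "normalized_lift \<gamma> = \<Gamma>"
  unfolding normalized_lift_def
proof (rule the_equality)
  show "is_normalized_lift \<gamma> \<Gamma>" by fact
next
  fix \<Delta> assume "is_normalized_lift \<gamma> \<Delta>"
  then show "\<Delta> = \<Gamma>"
    using assms normalized_local_lift_unique[of UNIV \<gamma> \<Delta> UNIV \<Gamma>]
    by (auto simp: is_normalized_lift_def)
qed

lemma is_normalized_lift_normalized_lift:
  assumes "locally_convex \<gamma>"
  shows "is_normalized_lift \<gamma> (normalized_lift \<gamma>)"
proof -
  have "\<forall>t. \<exists>V d. t \<in> V \<and> local_lift V \<gamma> d \<and> (\<forall>s\<in>V. wronskian d s = 1)"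
    using assms normalized_local_lift_exists unfolding locally_convex_def by blast
  from choice[OF this] obtain V where
    "\<forall>t. \<exists>d. t \<in> V t \<and> local_lift (V t) \<gamma> d \<and> (\<forall>s\<in>V t. wronskian d s = 1)" ..
  from choice[OF this] obtain d where
    "\<forall>t. t \<in> V t \<and> local_lift (V t) \<gamma> (d t) \<and> (\<forall>s\<in>V t. wronskian (d t) s = 1)" ..
  then have t: "t \<in> V t" and l: "local_lift (V t) \<gamma> (d t)"
    and w: "s \<in> V t \<Longrightarrow> wronskian (d t) s = 1" for s t by auto
  \<comment> \<open>Uniqueness makes the local lifts agree on overlaps, so this diagonal choice
    coincides with each of them on its whole domain.\<close>
  define \<Gamma> where "\<Gamma> t = d t t" for t
  have eq: "d t s = \<Gamma> s" if "s \<in> V t" for s t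
    unfolding \<Gamma>_def by (rule normalized_local_lift_unique[OF l w l w that t])
  have V: "open (V t)" and s: "smooth_on (V t) (d t)" for t
    using l[of t] by (auto simp: local_lift_def)
  have "smooth_on (V t) \<Gamma>" for t
    using s[of t] smooth_on_cong[of "V t" "d t" \<Gamma>] V eq by blast
  then have "smooth_on UNIV \<Gamma>" using V t by (intro smooth_on_local) blast
  moreover have "\<Gamma> t \<noteq> 0 \<and> \<gamma> t = proj_point (\<Gamma> t)" for t
    using l[of t] t[of t] by (auto simp: local_lift_def \<Gamma>_def)
  moreover have "wronskian \<Gamma> t = 1" for t
    using wronskian_cong[OF V s eq t] w[OF t] by simp
  ultimately have "is_normalized_lift \<gamma> \<Gamma>"
    by (simp add: is_normalized_lift_def local_lift_def)
  then show ?thesis using normalized_lift_eqI by simp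
qed

lemma curve_deriv_shift:
  assumes "smooth_on UNIV c"
  shows "curve_deriv (\<lambda>s. c (s + T)) = (\<lambda>s. curve_deriv c (s + T))"
proof
  fix t
  have "((\<lambda>s. c (s + T)) has_vector_derivative curve_deriv c (t + T)) (at t)"
  proof -
    have "((\<lambda>s. s + T) has_vector_derivative 1) (at t)"
      by (auto intro!: derivative_eq_intros)
    from vector_diff_chain_at[OF this has_vector_derivative_curve_deriv[OF assms]]
    show ?thesis by (simp add: o_def)
  qed
  then show "curve_deriv (\<lambda>s. c (s + T)) t = curve_deriv c (t + T)" by (rule curve_deriv_eqI)
qed

text \<open>The translate of the lift by \<open>T\<close> is again a normalized lift of the same
  curve, so uniqueness applies.\<close>

lemma normalized_lift_periodic:
  assumes "\<gamma> \<in> closed_projective_curves T"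
  shows "normalized_lift \<gamma> (t + T) = normalized_lift \<gamma> t"
proof -
  let ?\<Gamma> = "normalized_lift \<gamma>"
  have n: "is_normalized_lift \<gamma> ?\<Gamma>"
    using assms is_normalized_lift_normalized_lift by (auto simp: closed_projective_curves_def)
  then have s: "smooth_on UNIV ?\<Gamma>" by (simp add: is_normalized_lift_def local_lift_def)
  have "smooth_on UNIV (\<lambda>t. ?\<Gamma> (t + T))"
    by (rule smooth_on_compose_affine[OF bounded_linear_ident s])
  then have "is_normalized_lift \<gamma> (\<lambda>t. ?\<Gamma> (t + T))"
    using n assms
    by (auto simp: is_normalized_lift_def local_lift_def wronskian_eq curve_deriv_shift s
        smooth_on_curve_deriv closed_projective_curves_def)
  from normalized_lift_eqI[OF this] show ?thesis by (metis)
qed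


section \<open>From curves to friezes\<close>

definition lift_F :: "(real \<Rightarrow> real^3) \<Rightarrow> real \<Rightarrow> real \<Rightarrow> real" where
  "lift_F \<Gamma> x y = \<Gamma> x \<bullet> dual_lift \<Gamma> y"

lemma curve_F_eq_lift_F: "curve_F \<gamma> = lift_F (normalized_lift \<gamma>)"
  by (intro ext) (simp add: curve_F_def lift_F_def)

text \<open>For a unimodular frame the factor is 1: crossing
  \<open>\<Gamma> \<times> \<Gamma>'\<close> with \<open>\<Gamma> \<times> \<Gamma>''\<close> gives
  back \<open>\<Gamma>\<close>, that is, the dual of the dual curve is the curve.\<close>

lemma cross_cross_common: "(u \<times> v) \<times> (u \<times> w) = (u \<bullet> (v \<times> w)) *\<^sub>R u" for u :: "real^3"
  by (simp add: cross_cross_det dot_cross_det[symmetric] dot_cross_self)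

lemma triple_rotate: "u \<bullet> (v \<times> w) = v \<bullet> (w \<times> u)" "u \<bullet> (v \<times> w) = w \<bullet> (u \<times> v)" for u :: "real^3"
  by (metis cross_triple inner_commute)+

lemma swap_partials:
  "partial_x (\<lambda>x y. F y x) = (\<lambda>x y. partial_y F y x)"
  "partial_y (\<lambda>x y. F y x) = (\<lambda>x y. partial_x F y x)"
  by (simp_all add: partial_x_def[abs_def] partial_y_def[abs_def])

text \<open>Collects what the computations use, so that they serve both normalized lifts of given
  curves and the curves built from friezes.\<close>

locale unimodular_curve =
  fixes \<Gamma> :: "real \<Rightarrow> real^3" and T :: real
  assumes smooth: "smooth_on UNIV \<Gamma>"
    and wronskian: "wronskian \<Gamma> t = 1"
    and periodic: "\<Gamma> (t + T) = \<Gamma> t"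
begin

abbreviation \<Gamma>' where "\<Gamma>' \<equiv> curve_deriv \<Gamma>"
abbreviation \<Gamma>'' where "\<Gamma>'' \<equiv> curve_deriv \<Gamma>'"
abbreviation \<Gamma>''' where "\<Gamma>''' \<equiv> curve_deriv \<Gamma>''"

lemma smooths: "smooth_on UNIV \<Gamma>'" "smooth_on UNIV \<Gamma>''" "smooth_on UNIV \<Gamma>'''"
  by (intro smooth_on_curve_deriv open_UNIV smooth)+

lemma derivs:
  "(\<Gamma> has_vector_derivative \<Gamma>' t) (at t)"
  "(\<Gamma>' has_vector_derivative \<Gamma>'' t) (at t)"
  "(\<Gamma>'' has_vector_derivative \<Gamma>''' t) (at t)"
  by (intro has_vector_derivative_curve_deriv[of UNIV] smooth smooths UNIV_I)+

lemma frame: "\<Gamma> t \<bullet> (\<Gamma>' t \<times> \<Gamma>'' t) = 1"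
  using wronskian[of t] by (simp add: wronskian_eq)

lemma frame_rotated: "\<Gamma>'' t \<bullet> (\<Gamma> t \<times> \<Gamma>' t) = 1" "\<Gamma>' t \<bullet> (\<Gamma> t \<times> \<Gamma>'' t) = -1"
proof -
  show "\<Gamma>'' t \<bullet> (\<Gamma> t \<times> \<Gamma>' t) = 1" using frame[of t] triple_rotate(2) by metis
  have "\<Gamma>' t \<bullet> (\<Gamma>'' t \<times> \<Gamma> t) = 1" using frame[of t] triple_rotate(1) by metis
  then show "\<Gamma>' t \<bullet> (\<Gamma> t \<times> \<Gamma>'' t) = -1"
    using cross_skew[of "\<Gamma> t" "\<Gamma>'' t"] by simp
qed

lemma deriv_periodic: "\<Gamma>' (t + T) = \<Gamma>' t"
proof -
  have "(\<lambda>s. \<Gamma> (s + T)) = \<Gamma>" by (simp add: periodic)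
  then show ?thesis using fun_cong[OF curve_deriv_shift[OF smooth, of T], of t] by simp
qed

lemma nonzero: "\<Gamma> t \<noteq> 0"
  using frame[of t] by auto

lemma is_normalized_lift: "is_normalized_lift (\<lambda>t. proj_point (\<Gamma> t)) \<Gamma>"
  by (simp add: is_normalized_lift_def local_lift_def smooth nonzero wronskian)

lemma proj_point_closed: "(\<lambda>t. proj_point (\<Gamma> t)) \<in> closed_projective_curves T"
proof -
  have "local_lift UNIV (\<lambda>t. proj_point (\<Gamma> t)) \<Gamma>"
    using is_normalized_lift by (simp add: is_normalized_lift_def)
  then have "\<exists>U c. t \<in> U \<and> local_lift U (\<lambda>t. proj_point (\<Gamma> t)) c \<and> wronskian c t \<noteq> 0" for t
    by (intro exI[of _ UNIV] exI[of _ \<Gamma>]) (simp add: wronskian)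
  then have "locally_convex (\<lambda>t. proj_point (\<Gamma> t))"
    unfolding locally_convex_def ..
  moreover from this have "smooth_proj_curve (\<lambda>t. proj_point (\<Gamma> t))"
    unfolding locally_convex_def smooth_proj_curve_def by blast
  ultimately show ?thesis by (simp add: closed_projective_curves_def periodic)
qed

lemma lift_F_x: "((\<lambda>s. \<Gamma> s \<bullet> v) has_real_derivative \<Gamma>' x \<bullet> v) (at x)"
  "((\<lambda>s. \<Gamma>' s \<bullet> v) has_real_derivative \<Gamma>'' x \<bullet> v) (at x)"
  "((\<lambda>s. \<Gamma>'' s \<bullet> v) has_real_derivative \<Gamma>''' x \<bullet> v) (at x)"
  unfolding has_real_derivative_iff_has_vector_derivative
  by (intro bounded_linear.has_vector_derivative[OF bounded_linear_inner_left] derivs)+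

lemma dual_derivs:
  "((\<lambda>s. \<Gamma> s \<times> \<Gamma>' s) has_vector_derivative \<Gamma> y \<times> \<Gamma>'' y) (at y)"
  "((\<lambda>s. \<Gamma> s \<times> \<Gamma>'' s) has_vector_derivative \<Gamma>' y \<times> \<Gamma>'' y + \<Gamma> y \<times> \<Gamma>''' y) (at y)"
  using bounded_bilinear.has_vector_derivative[OF bounded_bilinear_cross3 derivs(1) derivs(2)]
    bounded_bilinear.has_vector_derivative[OF bounded_bilinear_cross3 derivs(1) derivs(3)]
  by (simp_all add: add.commute)

lemma lift_F_y:
  "((\<lambda>s. u \<bullet> (\<Gamma> s \<times> \<Gamma>' s)) has_real_derivative u \<bullet> (\<Gamma> y \<times> \<Gamma>'' y)) (at y)"
  "((\<lambda>s. u \<bullet> (\<Gamma> s \<times> \<Gamma>'' s)) has_real_derivative u \<bullet> (\<Gamma>' y \<times> \<Gamma>'' y + \<Gamma> y \<times> \<Gamma>''' y)) (at y)"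
  unfolding has_real_derivative_iff_has_vector_derivative
  by (intro bounded_linear.has_vector_derivative[OF bounded_linear_inner_right] dual_derivs)+

lemma lift_F_eq: "lift_F \<Gamma> = (\<lambda>x y. \<Gamma> x \<bullet> (\<Gamma> y \<times> \<Gamma>' y))"
  by (simp add: fun_eq_iff lift_F_def dual_lift_def)

lemma partials:
  "partial_x (lift_F \<Gamma>) = (\<lambda>x y. \<Gamma>' x \<bullet> (\<Gamma> y \<times> \<Gamma>' y))"
  "partial_y (lift_F \<Gamma>) = (\<lambda>x y. \<Gamma> x \<bullet> (\<Gamma> y \<times> \<Gamma>'' y))"
  "partial_x (\<lambda>x y. \<Gamma>' x \<bullet> (\<Gamma> y \<times> \<Gamma>' y)) = (\<lambda>x y. \<Gamma>'' x \<bullet> (\<Gamma> y \<times> \<Gamma>' y))"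
  "partial_y (\<lambda>x y. \<Gamma>' x \<bullet> (\<Gamma> y \<times> \<Gamma>' y)) = (\<lambda>x y. \<Gamma>' x \<bullet> (\<Gamma> y \<times> \<Gamma>'' y))"
  "partial_x (\<lambda>x y. \<Gamma> x \<bullet> (\<Gamma> y \<times> \<Gamma>'' y)) = (\<lambda>x y. \<Gamma>' x \<bullet> (\<Gamma> y \<times> \<Gamma>'' y))"
  "partial_y (\<lambda>x y. \<Gamma> x \<bullet> (\<Gamma> y \<times> \<Gamma>'' y)) = (\<lambda>x y. \<Gamma> x \<bullet> (\<Gamma>' y \<times> \<Gamma>'' y + \<Gamma> y \<times> \<Gamma>''' y))"
proof -
  have d: "deriv (\<lambda>s. \<Gamma> s \<bullet> v) = (\<lambda>x. \<Gamma>' x \<bullet> v)" "deriv (\<lambda>s. \<Gamma>' s \<bullet> v) = (\<lambda>x. \<Gamma>'' x \<bullet> v)"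
    "deriv (\<lambda>s. v \<bullet> (\<Gamma> s \<times> \<Gamma>' s)) = (\<lambda>y. v \<bullet> (\<Gamma> y \<times> \<Gamma>'' y))"
    "deriv (\<lambda>s. v \<bullet> (\<Gamma> s \<times> \<Gamma>'' s)) = (\<lambda>y. v \<bullet> (\<Gamma>' y \<times> \<Gamma>'' y + \<Gamma> y \<times> \<Gamma>''' y))" for v
    by (intro ext DERIV_imp_deriv lift_F_x lift_F_y)+
  show "partial_x (lift_F \<Gamma>) = (\<lambda>x y. \<Gamma>' x \<bullet> (\<Gamma> y \<times> \<Gamma>' y))"
    "partial_y (lift_F \<Gamma>) = (\<lambda>x y. \<Gamma> x \<bullet> (\<Gamma> y \<times> \<Gamma>'' y))"
    "partial_x (\<lambda>x y. \<Gamma>' x \<bullet> (\<Gamma> y \<times> \<Gamma>' y)) = (\<lambda>x y. \<Gamma>'' x \<bullet> (\<Gamma> y \<times> \<Gamma>' y))"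
    "partial_y (\<lambda>x y. \<Gamma>' x \<bullet> (\<Gamma> y \<times> \<Gamma>' y)) = (\<lambda>x y. \<Gamma>' x \<bullet> (\<Gamma> y \<times> \<Gamma>'' y))"
    "partial_x (\<lambda>x y. \<Gamma> x \<bullet> (\<Gamma> y \<times> \<Gamma>'' y)) = (\<lambda>x y. \<Gamma>' x \<bullet> (\<Gamma> y \<times> \<Gamma>'' y))"
    "partial_y (\<lambda>x y. \<Gamma> x \<bullet> (\<Gamma> y \<times> \<Gamma>'' y)) = (\<lambda>x y. \<Gamma> x \<bullet> (\<Gamma>' y \<times> \<Gamma>'' y + \<Gamma> y \<times> \<Gamma>''' y))"
    by (simp_all only: lift_F_eq partial_x_def[abs_def] partial_y_def[abs_def] d)
qed

lemmas lift_F_swap_partials = swap_partials[of "lift_F \<Gamma>"]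
  swap_partials[of "partial_x (lift_F \<Gamma>)"] swap_partials[of "partial_y (lift_F \<Gamma>)"]

text \<open>By the Lagrange identity the right side is the inner product of
  \<open>\<Gamma> x \<times> \<Gamma>' x\<close> with the cross product of
  \<open>\<Gamma> y \<times> \<Gamma>' y\<close> and
  \<open>\<Gamma> y \<times> \<Gamma>'' y\<close>, and the latter is
  \<open>\<Gamma> y\<close>.\<close>

lemma frieze_rule:
  "lift_F \<Gamma> y x = lift_F \<Gamma> x y * partial_y (partial_x (lift_F \<Gamma>)) x y -
     partial_x (lift_F \<Gamma>) x y * partial_y (lift_F \<Gamma>) x y"
proof -
  have "(\<Gamma> x \<times> \<Gamma>' x) \<bullet> ((\<Gamma> y \<times> \<Gamma>' y) \<times> (\<Gamma> y \<times> \<Gamma>'' y)) = \<Gamma> y \<bullet> (\<Gamma> x \<times> \<Gamma>' x)"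
    by (simp add: cross_cross_common frame inner_commute)
  then show ?thesis
    unfolding partials unfolding lift_F_eq by (simp add: dot_cross mult.commute)
qed

lemma lift_F_periodic: "lift_F \<Gamma> (x + T) y = lift_F \<Gamma> x y" "lift_F \<Gamma> x (y + T) = lift_F \<Gamma> x y"
  by (simp_all add: lift_F_eq periodic deriv_periodic)

lemma smooth2_lift_F: "smooth2 (lift_F \<Gamma>)"
proof -
  have "smooth_on UNIV (\<lambda>p. c (fst p))" "smooth_on UNIV (\<lambda>p. c (snd p))"
    if "smooth_on UNIV c" for c :: "real \<Rightarrow> real^3"
    using smooth_on_compose_real[OF open_UNIV open_UNIV that smooth_on_linear[OF open_UNIV bounded_linear_fst
          smooth_on_ident[OF open_UNIV]]]
      smooth_on_compose_real[OF open_UNIV open_UNIV that smooth_on_linear[OF open_UNIV bounded_linear_snd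
          smooth_on_ident[OF open_UNIV]]] by simp_all
  note p = this
  have "smooth_on UNIV (\<lambda>p. \<Gamma> (fst p) \<bullet> (\<Gamma> (snd p) \<times> \<Gamma>' (snd p)))"
    by (intro smooth_on_inner smooth_on_cross3 open_UNIV p smooth smooths)
  then show ?thesis by (simp add: lift_F_eq case_prod_unfold)
qed

lemma lift_F_frieze: "(lift_F \<Gamma>, \<lambda>x y. lift_F \<Gamma> y x) \<in> closed_friezes T"
proof -
  have b: "frieze_boundary (lift_F \<Gamma>)" "frieze_boundary (\<lambda>x y. lift_F \<Gamma> y x)"
    unfolding frieze_boundary_def lift_F_swap_partials unfolding partials unfolding lift_F_eq
    by (simp_all add: dot_cross_self inner_add_right frame frame_rotated)
  have r: "frieze_rule (lift_F \<Gamma>) (\<lambda>x y. lift_F \<Gamma> y x)"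
    unfolding frieze_rule_def using frieze_rule by blast
  \<comment> \<open>Exchanging the arguments turns the first rule into the second, up to the order
    of the mixed partials.\<close>
  have r': "frieze_rule (\<lambda>x y. lift_F \<Gamma> y x) (lift_F \<Gamma>)"
    unfolding frieze_rule_def lift_F_swap_partials partial_commute[OF smooth2_lift_F]
  proof (intro allI)
    fix x y
    show "lift_F \<Gamma> x y = lift_F \<Gamma> y x * partial_y (partial_x (lift_F \<Gamma>)) y x -
        partial_y (lift_F \<Gamma>) y x * partial_x (lift_F \<Gamma>) y x"
      using frieze_rule[of x y] by (simp only: mult.commute)
  qed
  show ?thesis
    using b r r' smooth2_lift_F smooth2_swap[OF smooth2_lift_F]
    by (simp add: closed_friezes_def frieze_periodic_def lift_F_periodic)
qed

section \<open>Recovering the lift from \<open>F\<close>\<close>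

definition dual_frame :: "real^3^3" where
  "dual_frame = vector [\<Gamma> 0 \<times> \<Gamma>' 0, \<Gamma> 0 \<times> \<Gamma>'' 0, \<Gamma>' 0 \<times> \<Gamma>'' 0 + \<Gamma> 0 \<times> \<Gamma>''' 0]"

text \<open>The rows are the dual curve and its first two derivatives at 0. The first two rows cross
  to \<open>\<Gamma> 0\<close>, whose product with the third is the frame determinant.\<close>

lemma det_dual_frame: "det dual_frame = 1"
proof -
  have "det dual_frame = (\<Gamma>' 0 \<times> \<Gamma>'' 0 + \<Gamma> 0 \<times> \<Gamma>''' 0) \<bullet> ((\<Gamma> 0 \<times> \<Gamma>' 0) \<times> (\<Gamma> 0 \<times> \<Gamma>'' 0))"
    unfolding dual_frame_def dot_cross_det[symmetric] by (rule triple_rotate)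
  also have "\<dots> = 1"
    by (simp add: cross_cross_common frame inner_add_left inner_add_right dot_cross_self
        inner_commute[of _ "\<Gamma> 0"])
  finally show ?thesis .
qed

lemma dual_frame_mult:
  "dual_frame *v \<Gamma> x =
     vector [lift_F \<Gamma> x 0, partial_y (lift_F \<Gamma>) x 0, partial_y (partial_y (lift_F \<Gamma>)) x 0]"
  unfolding partials unfolding lift_F_eq
  by (simp add: dual_frame_def vec_eq_iff forall_3 matrix_vector_mul_component
      inner_commute)

end

section \<open>Equality of \<open>F\<close> and equivalence of curves\<close>

lemma unimodular_curve_normalized_lift:
  assumes "\<gamma> \<in> closed_projective_curves T"
  shows "unimodular_curve (normalized_lift \<gamma>) T"
  using is_normalized_lift_normalized_lift[of \<gamma>] normalized_lift_periodic[OF assms] assms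
  by (unfold_locales) (auto simp: closed_projective_curves_def is_normalized_lift_def local_lift_def)

lemma proj_point_normalized_lift:
  assumes "\<gamma> \<in> closed_projective_curves T"
  shows "\<gamma> t = proj_point (normalized_lift \<gamma> t)"
  using is_normalized_lift_normalized_lift[of \<gamma>] assms
  by (auto simp: closed_projective_curves_def is_normalized_lift_def local_lift_def)

lemma curve_deriv_matrix:
  fixes A :: "real^3^3"
  assumes "smooth_on UNIV c"
  shows "curve_deriv (\<lambda>t. A *v c t) = (\<lambda>t. A *v curve_deriv c t)"
  by (intro ext curve_deriv_eqI has_vector_derivative_curve_deriv[OF assms] UNIV_I
      bounded_linear.has_vector_derivative[OF matrix_vector_mul_bounded_linear])

lemma inner_cross_matrix:
  fixes A :: "real^3^3"
  shows "(A *v u) \<bullet> ((A *v v) \<times> (A *v w)) = det A * (u \<bullet> (v \<times> w))"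
proof -
  have "(A *v u) \<bullet> ((A *v v) \<times> (A *v w)) = u \<bullet> (transpose A *v ((A *v v) \<times> (A *v w)))"
    using dot_lmul_matrix[of "(A *v v) \<times> (A *v w)" A u] by (simp add: inner_commute)
  then show ?thesis unfolding cross_matrix_mult by simp
qed

lemma image_proj_point:
  fixes A :: "real^3^3"
  shows "(\<lambda>v. A *v v) ` proj_point w = proj_point (A *v w)"
  using linear_span_image[OF matrix_vector_mul_linear, of A "{w}"] by (simp add: proj_point_def)

text \<open>The image of the normalized lift under \<open>A\<close> is the normalized lift of the
  image curve, and \<open>F\<close> is a determinant, unchanged by a matrix of determinant
  1.\<close>

lemma sl3_equiv_imp_curve_F_eq:
  assumes "(\<gamma>, \<delta>) \<in> sl3_equiv T"
  shows "curve_F \<gamma> = curve_F \<delta>"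
proof -
  let ?\<Gamma> = "normalized_lift \<gamma>"
  have \<gamma>: "\<gamma> \<in> closed_projective_curves T" using assms by (auto simp: sl3_equiv_def)
  obtain A :: "real^3^3" where A: "det A = 1" "\<And>t. \<delta> t = (\<lambda>v. A *v v) ` \<gamma> t"
    using assms by (auto simp: sl3_equiv_def)
  interpret unimodular_curve ?\<Gamma> T by (rule unimodular_curve_normalized_lift[OF \<gamma>])
  have sA: "smooth_on UNIV (\<lambda>t. A *v ?\<Gamma> t)"
    by (rule smooth_on_linear[OF open_UNIV matrix_vector_mul_bounded_linear smooth])
  have w: "wronskian (\<lambda>t. A *v ?\<Gamma> t) t = 1" for t
    by (simp add: wronskian_eq curve_deriv_matrix smooth smooths inner_cross_matrix A frame)
  have p: "proj_point (A *v ?\<Gamma> t) = \<delta> t" for t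
    using A(2) proj_point_normalized_lift[OF \<gamma>] image_proj_point by metis
  interpret A: unimodular_curve "\<lambda>t. A *v ?\<Gamma> t" T
    using sA w periodic by unfold_locales auto
  have "normalized_lift \<delta> = (\<lambda>t. A *v ?\<Gamma> t)"
    using A.is_normalized_lift by (intro normalized_lift_eqI) (simp add: p)
  moreover have "lift_F (\<lambda>t. A *v ?\<Gamma> t) = lift_F ?\<Gamma>"
    by (simp add: lift_F_eq A.lift_F_eq curve_deriv_matrix smooth inner_cross_matrix A)
  ultimately show ?thesis by (simp add: curve_F_eq_lift_F)
qed

lemma curve_F_eq_imp_sl3_equiv:
  assumes \<gamma>: "\<gamma> \<in> closed_projective_curves T" and \<delta>: "\<delta> \<in> closed_projective_curves T"
    and eq: "curve_F \<gamma> = curve_F \<delta>"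
  shows "(\<gamma>, \<delta>) \<in> sl3_equiv T"
proof -
  let ?\<Gamma> = "normalized_lift \<gamma>" and ?\<Delta> = "normalized_lift \<delta>"
  interpret \<Gamma>: unimodular_curve ?\<Gamma> T by (rule unimodular_curve_normalized_lift[OF \<gamma>])
  interpret \<Delta>: unimodular_curve ?\<Delta> T by (rule unimodular_curve_normalized_lift[OF \<delta>])
  obtain B where B: "B ** \<Delta>.dual_frame = mat 1"
    by (metis \<Delta>.det_dual_frame invertible_def invertible_det_nz zero_neq_one)
  have dB: "det B = 1" using B \<Delta>.det_dual_frame by (metis det_I det_mul mult.right_neutral)
  \<comment> \<open>Both dual frames send their lifts to the same vector of
    \<open>y\<close>-derivatives at \<open>y = 0\<close>; composing one with the inverse of the
    other maps lift to lift.\<close>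
  let ?A = "B ** \<Gamma>.dual_frame"
  have "?\<Delta> t = ?A *v ?\<Gamma> t" for t
  proof -
    have "?\<Delta> t = B *v (\<Delta>.dual_frame *v ?\<Delta> t)"
      by (simp add: matrix_vector_mul_assoc B)
    also have "\<Delta>.dual_frame *v ?\<Delta> t = \<Gamma>.dual_frame *v ?\<Gamma> t"
      using eq by (simp only: \<Gamma>.dual_frame_mult \<Delta>.dual_frame_mult curve_F_eq_lift_F)
    finally show ?thesis by (simp add: matrix_vector_mul_assoc)
  qed
  then have "\<delta> t = (\<lambda>v. ?A *v v) ` \<gamma> t" for t
    unfolding proj_point_normalized_lift[OF \<gamma>, of t] proj_point_normalized_lift[OF \<delta>, of t]
      image_proj_point by (rule arg_cong)
  moreover have "det ?A = 1" by (simp add: det_mul dB \<Gamma>.det_dual_frame)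
  ultimately show ?thesis using \<gamma> \<delta> unfolding sl3_equiv_def by blast
qed


section \<open>From friezes to curves\<close>

text \<open>The \<open>x\<close>-derivatives are taken first; by symmetry of mixed partials,
  differentiating in either variable raises its own index.\<close>

definition pd :: "(real \<Rightarrow> real \<Rightarrow> real) \<Rightarrow> nat \<Rightarrow> nat \<Rightarrow> real \<Rightarrow> real \<Rightarrow> real" where
  "pd F i j = (partial_y ^^ j) ((partial_x ^^ i) F)"

lemma smooth2_pd:
  assumes "smooth2 F"
  shows "smooth2 (pd F i j)"
proof -
  have "smooth2 ((partial_x ^^ i) F)"
    by (induction i) (simp_all add: assms smooth2_partial_x(2))
  then show ?thesis
    unfolding pd_def by (induction j) (simp_all add: smooth2_partial_y(2))
qed

lemma partial_y_pd: "partial_y (pd F i j) = pd F i (Suc j)"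
  by (simp add: pd_def)

lemma partial_x_pd:
  assumes "smooth2 F"
  shows "partial_x (pd F i j) = pd F (Suc i) j"
proof (induction j)
  case 0
  then show ?case by (simp add: pd_def)
next
  case (Suc j)
  have "partial_x (pd F i (Suc j)) = partial_y (partial_x (pd F i j))"
    unfolding partial_y_pd[symmetric] by (rule partial_commute[OF smooth2_pd[OF assms]])
  then show ?case by (simp add: Suc partial_y_pd)
qed

lemma pd_derivs:
  assumes "smooth2 F"
  shows "((\<lambda>s. pd F i j s y) has_real_derivative pd F (Suc i) j x y) (at x)"
    and "((\<lambda>s. pd F i j x s) has_real_derivative pd F i (Suc j) x y) (at y)"
  using smooth2_partial_x(1)[OF smooth2_pd[OF assms, of i j], where x=x and y=y]
    smooth2_partial_y(1)[OF smooth2_pd[OF assms, of i j], where x=x and y=y]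
  by (simp_all add: partial_x_pd[OF assms] partial_y_pd)

lemma pd_0_0: "pd F 0 0 = F" and pd_1_0: "pd F (Suc 0) 0 = partial_x F"
  and pd_0_1: "pd F 0 (Suc 0) = partial_y F" and pd_1_1: "pd F (Suc 0) (Suc 0) = partial_y (partial_x F)"
  and pd_2_0: "pd F (Suc (Suc 0)) 0 = partial_x (partial_x F)"
  and pd_0_2: "pd F 0 (Suc (Suc 0)) = partial_y (partial_y F)"
  by (simp_all add: pd_def)

lemma partial_y_zero_on_open:
  assumes "open U" "\<And>x y. (x, y) \<in> U \<Longrightarrow> H x y = 0" "(x, y) \<in> U"
  shows "partial_y H x y = 0"
proof -
  have o: "open (Pair x -` U)"
    using assms(1) by (rule open_vimage) (intro continuous_intros)
  have "((\<lambda>s. 0) has_real_derivative 0) (at y)" by simp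
  from has_field_derivative_transform_within_open[OF this o, of "H x"]
  have "((\<lambda>s. H x s) has_real_derivative 0) (at y)" using assms(2,3) by simp
  then show ?thesis unfolding partial_y_def by (rule DERIV_imp_deriv)
qed

text \<open>The expansion in basis vectors reduces smoothness and derivatives to those of sums and
  scalings.\<close>

definition vec3 :: "real \<Rightarrow> real \<Rightarrow> real \<Rightarrow> real^3" where
  "vec3 a b c = a *\<^sub>R axis 1 1 + b *\<^sub>R axis 2 1 + c *\<^sub>R axis 3 1"

lemma vec3_nth [simp]: "vec3 a b c $ 1 = a" "vec3 a b c $ 2 = b" "vec3 a b c $ 3 = c"
  by (simp_all add: vec3_def axis_def)

lemma triple_vec3:
  "vec3 a b c \<bullet> (vec3 d e f \<times> vec3 g h i) = a * (e * i - f * h) - b * (d * i - f * g) + c * (d * h - e * g)"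
  by (simp add: cross3_def inner_vec_def sum_3 algebra_simps)

lemma smooth_on_vec3:
  assumes "open S" "smooth_on S f" "smooth_on S g" "smooth_on S h"
  shows "smooth_on S (\<lambda>x. vec3 (f x) (g x) (h x))"
  unfolding vec3_def by (intro smooth_on_add smooth_on_scaleR smooth_on_const assms)

lemma has_vector_derivative_vec3:
  assumes "(f has_real_derivative f') (at x)" "(g has_real_derivative g') (at x)"
    "(h has_real_derivative h') (at x)"
  shows "((\<lambda>x. vec3 (f x) (g x) (h x)) has_vector_derivative vec3 f' g' h') (at x)"
  unfolding vec3_def
  using assms unfolding has_real_derivative_iff_has_vector_derivative
  by (intro has_vector_derivative_add bounded_linear.has_vector_derivative[OF bounded_linear_scaleR_left])

lemma cramer_vec3:
  fixes u v w z :: "real^3"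
  shows "(u \<bullet> (v \<times> w)) *\<^sub>R z =
    (z \<bullet> (v \<times> w)) *\<^sub>R u + (z \<bullet> (w \<times> u)) *\<^sub>R v + (z \<bullet> (u \<times> v)) *\<^sub>R w"
  by (simp add: cross3_def inner_vec_def sum_3 vec_eq_iff forall_3 algebra_simps)

section \<open>The matrix of mixed partials of a frieze and its determinant\<close>

locale frieze =
  fixes F G :: "real \<Rightarrow> real \<Rightarrow> real" and T :: real
  assumes frieze: "(F, G) \<in> closed_friezes T"
begin

lemma smooth_F: "smooth2 F" and rule_F: "G x y = F x y * partial_y (partial_x F) x y - partial_x F x y * partial_y F x y"
  and rule_G: "F x y = G x y * partial_y (partial_x G) x y - partial_x G x y * partial_y G x y"
  and boundary: "frieze_boundary F"
  and periodic: "F (x + T) y = F x y"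
proof -
  have c: "smooth2 F \<and> frieze_rule F G \<and> frieze_rule G F \<and> frieze_boundary F \<and> frieze_periodic T F"
    using frieze by (simp add: closed_friezes_def)
  then show "smooth2 F" "frieze_boundary F" by blast+
  show "F (x + T) y = F x y" using c unfolding frieze_periodic_def by blast
  show "G x y = F x y * partial_y (partial_x F) x y - partial_x F x y * partial_y F x y"
    "F x y = G x y * partial_y (partial_x G) x y - partial_x G x y * partial_y G x y"
    using c unfolding frieze_rule_def by blast+
qed

text \<open>Row \<open>i\<close> of the matrix of mixed partials. Differentiation in
  \<open>x\<close> moves to the next row, so for fixed \<open>y\<close> the determinant
  \<open>tau\<close> is the Wronskian of the curve traced by \<open>jet 0\<close>.\<close>

definition jet :: "nat \<Rightarrow> real \<Rightarrow> real \<Rightarrow> real^3" where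
  "jet i x y = vec3 (pd F i 0 x y) (pd F i 1 x y) (pd F i 2 x y)"

definition tau :: "real \<Rightarrow> real \<Rightarrow> real" where
  "tau x y = jet 0 x y \<bullet> (jet 1 x y \<times> jet 2 x y)"

lemma smooth_jet: "smooth_on UNIV (\<lambda>(x, y). jet i x y)"
  using smooth_on_vec3[OF open_UNIV smooth2_pd[OF smooth_F, of i 0] smooth2_pd[OF smooth_F, of i 1]
      smooth2_pd[OF smooth_F, of i 2]]
  by (simp add: jet_def case_prod_unfold)

lemma smooth_jet_triple: "smooth2 (\<lambda>x y. jet i x y \<bullet> (jet j x y \<times> jet k x y))"
  using smooth_on_inner[OF open_UNIV smooth_jet[of i] smooth_on_cross3[OF open_UNIV smooth_jet[of j] smooth_jet[of k]]]
  by (simp add: case_prod_unfold)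

lemma jet_deriv: "((\<lambda>s. jet i s y) has_vector_derivative jet (Suc i) x y) (at x)"
  unfolding jet_def by (intro has_vector_derivative_vec3 pd_derivs smooth_F)

lemma jet_derivs:
  "((\<lambda>s. jet 0 s y) has_vector_derivative jet 1 x y) (at x)"
  "((\<lambda>s. jet 1 s y) has_vector_derivative jet 2 x y) (at x)"
  "((\<lambda>s. jet 2 s y) has_vector_derivative jet 3 x y) (at x)"
  using jet_deriv[of 0 y x] jet_deriv[of 1 y x] jet_deriv[of 2 y x]
  by (simp_all add: numeral_2_eq_2 numeral_3_eq_3)

lemma G_eq: "G = (\<lambda>x y. pd F 0 0 x y * pd F 1 1 x y - pd F 1 0 x y * pd F 0 1 x y)"
  using rule_F by (intro ext) (simp add: pd_0_0 pd_0_1 pd_1_0 pd_1_1)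

text \<open>\<open>G\<close> is the leading 2 by 2 minor. Differentiating a minor raises the index
  of its last row or column, the other terms cancelling; this gives the four minors containing the
  corner entry \<open>F\<close> that condensation needs.\<close>

lemma partial_G:
  "partial_x G = (\<lambda>x y. pd F 0 0 x y * pd F 2 1 x y - pd F 2 0 x y * pd F 0 1 x y)"
  "partial_y G = (\<lambda>x y. pd F 0 0 x y * pd F 1 2 x y - pd F 1 0 x y * pd F 0 2 x y)"
  "partial_y (partial_x G) = (\<lambda>x y. pd F 0 0 x y * pd F 2 2 x y - pd F 2 0 x y * pd F 0 2 x y)"
proof -
  note d = pd_derivs[OF smooth_F]
  show x: "partial_x G = (\<lambda>x y. pd F 0 0 x y * pd F 2 1 x y - pd F 2 0 x y * pd F 0 1 x y)"
    unfolding G_eq partial_x_def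
    by (intro ext DERIV_imp_deriv) (auto intro!: derivative_eq_intros d simp: numeral_2_eq_2)
  show "partial_y G = (\<lambda>x y. pd F 0 0 x y * pd F 1 2 x y - pd F 1 0 x y * pd F 0 2 x y)"
    unfolding G_eq partial_y_def
    by (intro ext DERIV_imp_deriv) (auto intro!: derivative_eq_intros d simp: numeral_2_eq_2)
  show "partial_y (partial_x G) = (\<lambda>x y. pd F 0 0 x y * pd F 2 2 x y - pd F 2 0 x y * pd F 0 2 x y)"
    unfolding x partial_y_def
    by (intro ext DERIV_imp_deriv) (auto intro!: derivative_eq_intros d simp: numeral_2_eq_2)
qed

text \<open>The Desnanot--Jacobi identity for the matrix of partial derivatives of \<open>F\<close>.\<close>

lemma tau_mult_F: "tau x y * F x y = F x y"
proof -
  have "tau x y * F x y = G x y * partial_y (partial_x G) x y - partial_x G x y * partial_y G x y"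
    unfolding partial_G(3) unfolding partial_G(1,2) unfolding G_eq tau_def jet_def triple_vec3
    by (simp add: pd_0_0 algebra_simps)
  then show ?thesis using rule_G by simp
qed

lemma diag:
  "pd F 0 0 x x = 0" "pd F 1 0 x x = 0" "pd F 2 0 x x = 1" "pd F 0 1 x x = 0" "pd F 1 1 x x = - 1"
  "pd F 0 2 x x = 1"
  using boundary unfolding frieze_boundary_def
  by (simp_all add: numeral_2_eq_2 pd_0_0 pd_0_1 pd_1_0 pd_1_1 pd_2_0 pd_0_2)

lemma tau_diag: "tau x x = 1"
  by (simp add: tau_def jet_def triple_vec3 diag[unfolded One_nat_def])

lemma smooth_tau: "smooth2 tau"
  unfolding tau_def[abs_def] by (rule smooth_jet_triple)

text \<open>All \<open>y\<close>-derivatives of \<open>F\<close> vanish on the open set too, so the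
  first row of the determinant is zero.\<close>

lemma tau_zero_of_F_zero:
  assumes "open U" "\<And>x y. (x, y) \<in> U \<Longrightarrow> F x y = 0" "(x, y) \<in> U"
  shows "tau x y = 0"
proof -
  have 0: "pd F 0 j x y = 0" if "(x, y) \<in> U" for j x y
    using that
  proof (induction j arbitrary: x y)
    case 0
    then show ?case using assms(2) by (simp add: pd_0_0)
  next
    case (Suc j)
    then show ?case
      using partial_y_zero_on_open[OF assms(1), of "pd F 0 j"] by (simp add: partial_y_pd)
  qed
  show ?thesis by (simp add: tau_def jet_def triple_vec3 0[OF assms(3)])
qed

lemma continuous_tau: "continuous_on UNIV (\<lambda>(x, y). tau x y)"
  using smooth_on_continuous_on[OF smooth_tau] .

lemma tau_eq_1: "tau x y = 1"
proof -
  let ?t = "\<lambda>(x, y). tau x y"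
  have 01: "tau x y = 0 \<or> tau x y = 1" for x y
  proof (cases "tau x y = 1")
    case False
    have "open (?t -` (- {1}))"
      using continuous_tau by (intro open_vimage) auto
    moreover have "F x y = 0" if "(x, y) \<in> ?t -` (- {1})" for x y
      using tau_mult_F[of x y] that by simp
    ultimately show ?thesis
      using tau_zero_of_F_zero[of "?t -` (- {1})" x y] False by simp
  qed simp
  have "connected (range ?t)"
    by (rule connected_continuous_image[OF continuous_tau]) (rule connected_UNIV)
  moreover have "tau x y \<in> range ?t" by (rule range_eqI[of _ _ "(x, y)"]) simp
  moreover have "1 \<in> range ?t" by (rule range_eqI[of _ _ "(0, 0)"]) (simp add: tau_diag)
  \<comment> \<open>A connected set of reals is an interval; a value 0 would force the value 1/2,
    which \<open>tau\<close> never takes.\<close>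
  ultimately have "{tau x y..1} \<subseteq> range ?t"
    by (simp add: connected_contains_Icc)
  moreover have "1 / 2 \<notin> range ?t"
  proof
    assume "1 / 2 \<in> range ?t"
    then obtain a b where "tau a b = 1 / 2" by (metis (no_types, lifting) imageE old.prod.case surj_pair)
    then show False using 01[of a b] by simp
  qed
  moreover have "1 / 2 \<in> {tau x y..1}" if "tau x y \<le> 1 / 2" using that by simp
  ultimately have "\<not> tau x y \<le> 1 / 2" by blast
  then show ?thesis using 01[of x y] by auto
qed

section \<open>Nonvanishing of \<open>F\<close> and \<open>G\<close> on open sets\<close>

lemma F_dense:
  assumes "open U" "U \<noteq> {}"
  shows "\<exists>x y. (x, y) \<in> U \<and> F x y \<noteq> 0"
proof (rule ccontr)
  assume "\<not> ?thesis"
  then have "tau x y = 0" if "(x, y) \<in> U" for x y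
    using tau_zero_of_F_zero[OF assms(1)] that by blast
  then show False using assms(2) tau_eq_1 by auto
qed

text \<open>On an open set of zeros of \<open>G\<close> its \<open>y\<close>-derivative vanishes as
  well, so the rule for \<open>G\<close> would give \<open>F = 0\<close> there.\<close>

lemma G_dense:
  assumes "open U" "U \<noteq> {}"
  shows "\<exists>x y. (x, y) \<in> U \<and> G x y \<noteq> 0"
proof (rule ccontr)
  assume "\<not> ?thesis"
  then have 0: "G x y = 0" if "(x, y) \<in> U" for x y using that by blast
  have "F x y = 0" if "(x, y) \<in> U" for x y
    using rule_G[of x y] 0[OF that] partial_y_zero_on_open[OF assms(1) 0 that] by simp
  then show False using F_dense[OF assms] by blast
qed

text \<open>A nonzero value of \<open>H\<close> persists on an open set, which contains a point
  where \<open>G\<close> is nonzero.\<close>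

lemma zero_of_mult_G:
  assumes "smooth2 H" "\<And>x y. H x y * G x y = 0"
  shows "H x y = 0"
proof (rule ccontr)
  assume "H x y \<noteq> 0"
  let ?U = "(\<lambda>(x, y). H x y) -` (- {0})"
  have "open ?U"
    using smooth_on_continuous_on[OF assms(1)] by (intro open_vimage) auto
  moreover have "(x, y) \<in> ?U" using \<open>H x y \<noteq> 0\<close> by simp
  ultimately obtain a b where "(a, b) \<in> ?U" "G a b \<noteq> 0"
    using G_dense[of ?U] by blast
  then show False using assms(2)[of a b] by simp
qed

section \<open>The linear differential equation satisfied by \<open>F\<close> in
  \<open>x\<close>\<close>

definition "c0 x y = jet 3 x y \<bullet> (jet 1 x y \<times> jet 2 x y)"
definition "c1 x y = jet 3 x y \<bullet> (jet 2 x y \<times> jet 0 x y)"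

text \<open>This is the coefficient of \<open>jet 2\<close> in the expansion of
  \<open>jet 3\<close>; up to rotation it is the \<open>x\<close>-derivative of the constant
  \<open>tau\<close>.\<close>

lemma jet_3_triple: "jet 3 x y \<bullet> (jet 0 x y \<times> jet 1 x y) = 0"
proof -
  have "((\<lambda>s. jet 0 s y \<bullet> (jet 1 s y \<times> jet 2 s y)) has_vector_derivative
      jet 0 x y \<bullet> (jet 1 x y \<times> jet 3 x y + jet 2 x y \<times> jet 2 x y) + jet 1 x y \<bullet> (jet 1 x y \<times> jet 2 x y)) (at x)"
    by (intro bounded_bilinear.has_vector_derivative[OF bounded_bilinear_inner]
        bounded_bilinear.has_vector_derivative[OF bounded_bilinear_cross3] jet_derivs)
  moreover have "(\<lambda>s. jet 0 s y \<bullet> (jet 1 s y \<times> jet 2 s y)) = (\<lambda>s. 1)"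
    using tau_eq_1 by (simp add: tau_def)
  ultimately have "((\<lambda>s. 1) has_vector_derivative jet 0 x y \<bullet> (jet 1 x y \<times> jet 3 x y)) (at x)"
    by (simp add: dot_cross_self)
  then have "jet 0 x y \<bullet> (jet 1 x y \<times> jet 3 x y) = 0"
    using vector_derivative_at[OF has_vector_derivative_const] vector_derivative_at by metis
  then show ?thesis by (metis triple_rotate(2))
qed

text \<open>Cramer's rule in the basis \<open>jet 0\<close>, \<open>jet 1\<close>,
  \<open>jet 2\<close>, whose determinant \<open>tau\<close> is 1; hence \<open>c0\<close> and
  \<open>c1\<close> carry no denominators.\<close>

lemma jet_3: "jet 3 x y = c0 x y *\<^sub>R jet 0 x y + c1 x y *\<^sub>R jet 1 x y"
  using cramer_vec3[of "jet 0 x y" "jet 1 x y" "jet 2 x y" "jet 3 x y"]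
  unfolding tau_eq_1[unfolded tau_def] jet_3_triple c0_def c1_def by simp

lemma pd_3:
  "pd F 3 0 x y = c0 x y * pd F 0 0 x y + c1 x y * pd F 1 0 x y"
  "pd F 3 1 x y = c0 x y * pd F 0 1 x y + c1 x y * pd F 1 1 x y"
  "pd F 3 2 x y = c0 x y * pd F 0 2 x y + c1 x y * pd F 1 2 x y"
  using arg_cong[OF jet_3[of x y], of "\<lambda>v. v $ 1"] arg_cong[OF jet_3[of x y], of "\<lambda>v. v $ 2"]
    arg_cong[OF jet_3[of x y], of "\<lambda>v. v $ 3"]
  by (simp_all add: jet_def)

lemma smooth_c: "smooth2 c0" "smooth2 c1"
  unfolding c0_def[abs_def] c1_def[abs_def] by (rule smooth_jet_triple)+

text \<open>Differentiating a component of the equation in \<open>y\<close> and subtracting the next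
  one leaves a homogeneous relation between the \<open>y\<close>-derivatives of \<open>c0\<close>
  and \<open>c1\<close>. Two such relations form a system with determinant \<open>G\<close>, which
  is nonzero somewhere in every nonempty open set.\<close>

lemma c_partial_y: "partial_y c0 x y = 0" "partial_y c1 x y = 0"
proof -
  have eq: "partial_y c0 x y * pd F 0 j x y + partial_y c1 x y * pd F 1 j x y = 0"
    if h: "\<And>x y. pd F 3 j x y = c0 x y * pd F 0 j x y + c1 x y * pd F 1 j x y"
      "pd F 3 (Suc j) x y = c0 x y * pd F 0 (Suc j) x y + c1 x y * pd F 1 (Suc j) x y" for j x y
  proof -
    have "((\<lambda>s. c0 x s * pd F 0 j x s + c1 x s * pd F 1 j x s) has_real_derivative
        (partial_y c0 x y * pd F 0 j x y + c0 x y * pd F 0 (Suc j) x y) +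
        (partial_y c1 x y * pd F 1 j x y + c1 x y * pd F 1 (Suc j) x y)) (at y)"
      by (auto intro!: derivative_eq_intros pd_derivs smooth_F smooth2_partial_y(1) smooth_c)
    then have "((\<lambda>s. pd F 3 j x s) has_real_derivative
        (partial_y c0 x y * pd F 0 j x y + c0 x y * pd F 0 (Suc j) x y) +
        (partial_y c1 x y * pd F 1 j x y + c1 x y * pd F 1 (Suc j) x y)) (at y)"
      unfolding h(1)[symmetric] .
    from DERIV_unique[OF this pd_derivs(2)[OF smooth_F]] h(2) show ?thesis by simp
  qed
  have e0: "partial_y c0 x y * pd F 0 0 x y + partial_y c1 x y * pd F 1 0 x y = 0" for x y
    by (rule eq) (use pd_3 in simp_all)
  have e1: "partial_y c0 x y * pd F 0 1 x y + partial_y c1 x y * pd F 1 1 x y = 0" for x y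
    by (rule eq) (use pd_3 in \<open>simp_all add: numeral_2_eq_2\<close>)
  have "partial_y c0 x y * G x y = 0" for x y
  proof -
    have "partial_y c0 x y * G x y =
        (partial_y c0 x y * pd F 0 0 x y + partial_y c1 x y * pd F 1 0 x y) * pd F 1 1 x y
        - (partial_y c0 x y * pd F 0 1 x y + partial_y c1 x y * pd F 1 1 x y) * pd F 1 0 x y"
      unfolding G_eq by (simp only: algebra_simps)
    then show ?thesis unfolding e0 e1 by simp
  qed
  then show "partial_y c0 x y = 0" by (rule zero_of_mult_G[OF smooth2_partial_y(2)[OF smooth_c(1)]])
  have "partial_y c1 x y * G x y = 0" for x y
  proof -
    have "partial_y c1 x y * G x y =
        (partial_y c0 x y * pd F 0 1 x y + partial_y c1 x y * pd F 1 1 x y) * pd F 0 0 x y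
        - (partial_y c0 x y * pd F 0 0 x y + partial_y c1 x y * pd F 1 0 x y) * pd F 0 1 x y"
      unfolding G_eq by (simp only: algebra_simps)
    then show ?thesis unfolding e0 e1 by simp
  qed
  then show "partial_y c1 x y = 0" by (rule zero_of_mult_G[OF smooth2_partial_y(2)[OF smooth_c(2)]])
qed

lemma c_const: "c0 x y = c0 x 0" "c1 x y = c1 x 0"
  using DERIV_isconst_all[of "c0 x" y 0] DERIV_isconst_all[of "c1 x" y 0]
    smooth2_partial_y(1)[OF smooth_c(1)] smooth2_partial_y(1)[OF smooth_c(2)]
  by (simp_all add: c_partial_y)

section \<open>Reconstruction of the curve from the frieze\<close>

definition lift :: "real \<Rightarrow> real^3" where "lift x = jet 0 x 0"

lemma lift_derivs: "curve_deriv lift = (\<lambda>x. jet 1 x 0)" "curve_deriv (\<lambda>x. jet 1 x 0) = (\<lambda>x. jet 2 x 0)"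
  unfolding lift_def[abs_def] by (intro ext curve_deriv_eqI jet_derivs)+

lemma smooth_lift: "smooth_on UNIV lift"
proof -
  have "bounded_linear (\<lambda>x::real. (x, 0::real))" by (intro bounded_linear_intros)
  from smooth_on_compose_affine[OF this smooth_jet[of 0], of 0]
  show ?thesis by (simp add: lift_def[abs_def])
qed

lemma lift_periodic: "lift (x + T) = lift x"
proof -
  have "F (x + T) = F x" using periodic by auto
  then show ?thesis
    by (simp add: lift_def jet_def numeral_2_eq_2 pd_0_0 pd_0_1 pd_0_2 partial_y_def)
qed

sublocale unimodular_curve lift T
proof
  show "wronskian lift t = 1" for t
    using tau_eq_1[of t 0] unfolding wronskian_eq lift_derivs tau_def by (simp add: lift_def)
qed (rule smooth_lift lift_periodic)+

lemma F_eq_lift_F: "F = lift_F lift"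
proof (intro ext)
  fix x y
  \<comment> \<open>The vector whose inner products with \<open>jet 0\<close>, \<open>jet 1\<close>,
    \<open>jet 2\<close> at (x, 0) are \<open>F\<close>, its first and its second
    \<open>x\<close>-derivative at (x, y). Since the lift and \<open>F\<close> solve the same
    equation, \<open>b\<close> does not depend on \<open>x\<close>.\<close>
  define b where "b x = F x y *\<^sub>R (jet 1 x 0 \<times> jet 2 x 0) + pd F 1 0 x y *\<^sub>R (jet 2 x 0 \<times> jet 0 x 0)
    + pd F 2 0 x y *\<^sub>R (jet 0 x 0 \<times> jet 1 x 0)" for x
  have "(b has_vector_derivative 0) (at x)" for x
  proof -
    note cross = bounded_bilinear.has_vector_derivative[OF bounded_bilinear_cross3]
    note scale = bounded_bilinear.has_vector_derivative[OF bounded_bilinear_scaleR]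
    note pdv = pd_derivs(1)[OF smooth_F, unfolded has_real_derivative_iff_has_vector_derivative]
    have pdvs: "((\<lambda>s. F s y) has_vector_derivative pd F 1 0 x y) (at x)"
      "((\<lambda>s. pd F 1 0 s y) has_vector_derivative pd F 2 0 x y) (at x)"
      "((\<lambda>s. pd F 2 0 s y) has_vector_derivative pd F 3 0 x y) (at x)"
      using pdv[of 0 0 y x] pdv[of 1 0 y x] pdv[of 2 0 y x]
      by (simp_all add: numeral_2_eq_2 numeral_3_eq_3 pd_0_0)
    have "(b has_vector_derivative
       ((F x y *\<^sub>R (jet 1 x 0 \<times> jet 3 x 0 + jet 2 x 0 \<times> jet 2 x 0) + pd F 1 0 x y *\<^sub>R (jet 1 x 0 \<times> jet 2 x 0))
       + (pd F 1 0 x y *\<^sub>R (jet 2 x 0 \<times> jet 1 x 0 + jet 3 x 0 \<times> jet 0 x 0) + pd F 2 0 x y *\<^sub>R (jet 2 x 0 \<times> jet 0 x 0)))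
       + (pd F 2 0 x y *\<^sub>R (jet 0 x 0 \<times> jet 2 x 0 + jet 1 x 0 \<times> jet 1 x 0) + pd F 3 0 x y *\<^sub>R (jet 0 x 0 \<times> jet 1 x 0)))
       (at x)"
      unfolding b_def[abs_def]
      by (intro has_vector_derivative_add scale cross jet_derivs pdvs)
    moreover have "jet 3 x 0 = c0 x 0 *\<^sub>R jet 0 x 0 + c1 x 0 *\<^sub>R jet 1 x 0" by (rule jet_3)
    moreover have "pd F 3 0 x y = c0 x 0 * F x y + c1 x 0 * pd F 1 0 x y"
      using pd_3(1)[of x y] c_const[of x y] by (simp add: pd_0_0)
    ultimately show ?thesis
      by (simp add: cross_add_left cross_add_right cross_mult_left cross_mult_right scaleR_add_left
          scaleR_add_right cross_skew[of "jet 2 x 0" "jet 1 x 0"] cross_skew[of "jet 2 x 0" "jet 0 x 0"]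
          cross_skew[of "jet 1 x 0" "jet 0 x 0"] algebra_simps
          del: One_nat_def)
  qed
  then have "b x = b y"
    using has_vector_derivative_zero_constant[of UNIV b]
    by (metis UNIV_I convex_UNIV)
  \<comment> \<open>On the diagonal the boundary values are 0, 0, 1, so only the last term survives;
    it is the dual curve at \<open>y\<close>.\<close>
  also have "b y = jet 0 y 0 \<times> jet 1 y 0"
    using diag[of y] by (simp add: b_def pd_0_0)
  finally have "jet 0 x 0 \<bullet> b x = jet 0 x 0 \<bullet> (jet 0 y 0 \<times> jet 1 y 0)" by simp
  moreover have "jet 0 x 0 \<bullet> b x = F x y"
    using tau_eq_1[of x 0] by (simp add: b_def inner_add_right dot_cross_self tau_def)
  ultimately show "F x y = lift_F lift x y"
    unfolding lift_F_eq lift_derivs by (simp add: lift_def)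
qed

lemma ex_curve: "\<exists>\<gamma>\<in>closed_projective_curves T. curve_F \<gamma> = F \<and> curve_G \<gamma> = G"
proof (intro bexI conjI)
  let ?\<gamma> = "\<lambda>t. proj_point (lift t)"
  show F: "curve_F ?\<gamma> = F"
    unfolding curve_F_eq_lift_F normalized_lift_eqI[OF is_normalized_lift]
    by (rule F_eq_lift_F[symmetric])
  show "curve_G ?\<gamma> = G"
  proof (intro ext)
    fix x y show "curve_G ?\<gamma> x y = G x y"
      unfolding curve_G_def F
      \<comment> \<open>The rule for the curve and the rule for the given pair express both second
        functions by the same formula in \<open>F\<close>.\<close>
      by (rule trans[OF frieze_rule[of y x, folded F_eq_lift_F] rule_F[symmetric]])
  qed
qed (rule proj_point_closed)

end


section \<open>Positivity and convexity\<close>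

lemma vanishing_order_eqI:
  assumes "\<And>k. k < n \<Longrightarrow> (deriv ^^ k) f t = 0" "(deriv ^^ n) f t \<noteq> 0"
  shows "vanishing_order f t = enat n"
proof -
  have "(LEAST n. (deriv ^^ n) f t \<noteq> 0) = n"
    by (rule Least_equality) (use assms not_less in blast)+
  then show ?thesis using assms(2) by (auto simp: vanishing_order_def)
qed

lemma periodic_int:
  fixes f :: "real \<Rightarrow> 'a"
  assumes "\<And>x. f (x + T) = f x"
  shows "f (x + of_int k * T) = f x"
proof -
  have n: "f (x + of_nat n * T) = f x" for x n
  proof (induction n)
    case (Suc n)
    have "f (x + of_nat (Suc n) * T) = f ((x + of_nat n * T) + T)"
      by (simp add: algebra_simps)
    then show ?case using assms Suc by simp
  qed simp
  show ?thesis
  proof (cases k rule: int_cases2)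
    case (nonneg n)
    then show ?thesis using n by simp
  next
    case (nonpos n)
    then show ?thesis using n[of "x + of_int k * T" n] by simp
  qed
qed

text \<open>Intersections are counted over one period only; this moves arbitrary parameters
  there.\<close>

lemma ex_int_shift:
  assumes "T > (0::real)"
  shows "\<exists>k::int. x + of_int k * T \<in> {0..<T}"
proof -
  have "of_int \<lfloor>x / T\<rfloor> \<le> x / T" "x / T < of_int \<lfloor>x / T\<rfloor> + 1" by linarith+
  then have "of_int \<lfloor>x / T\<rfloor> * T \<le> x" "x < (of_int \<lfloor>x / T\<rfloor> + 1) * T"
    by (simp_all only: pos_le_divide_eq[OF assms] pos_divide_less_eq[OF assms])
  then show ?thesis by (intro exI[of _ "- \<lfloor>x / T\<rfloor>"]) (simp add: algebra_simps)
qed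

text \<open>Expansion of \<open>z\<close> in the basis of cross products dual to \<open>u\<close>,
  \<open>v\<close>, \<open>w\<close>; it recovers the normal vector of a line from its values on a
  frame.\<close>

lemma dual_cramer:
  fixes u v w z :: "real^3"
  shows "(u \<bullet> (v \<times> w)) *\<^sub>R z =
    (z \<bullet> u) *\<^sub>R (v \<times> w) + (z \<bullet> v) *\<^sub>R (w \<times> u) + (z \<bullet> w) *\<^sub>R (u \<times> v)"
  by (simp add: cross3_def inner_vec_def sum_3 vec_eq_iff forall_3 algebra_simps)

section \<open>Contact of a unimodular curve with lines\<close>

context unimodular_curve
begin

lemma iterated_deriv:
  "(deriv ^^ Suc 0) (\<lambda>s. a \<bullet> \<Gamma> s) = (\<lambda>s. a \<bullet> \<Gamma>' s)"
  "(deriv ^^ Suc (Suc 0)) (\<lambda>s. a \<bullet> \<Gamma> s) = (\<lambda>s. a \<bullet> \<Gamma>'' s)"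
proof -
  have "deriv (\<lambda>s. a \<bullet> \<Gamma> s) = (\<lambda>s. a \<bullet> \<Gamma>' s)" "deriv (\<lambda>s. a \<bullet> \<Gamma>' s) = (\<lambda>s. a \<bullet> \<Gamma>'' s)"
    using lift_F_x(1)[of a] lift_F_x(2)[of a]
    by (auto intro!: ext DERIV_imp_deriv simp: inner_commute)
  then show "(deriv ^^ Suc 0) (\<lambda>s. a \<bullet> \<Gamma> s) = (\<lambda>s. a \<bullet> \<Gamma>' s)"
    "(deriv ^^ Suc (Suc 0)) (\<lambda>s. a \<bullet> \<Gamma> s) = (\<lambda>s. a \<bullet> \<Gamma>'' s)" by simp_all
qed

lemma tangent_line:
  assumes "a \<bullet> \<Gamma> t = 0" "a \<bullet> \<Gamma>' t = 0"
  shows "a = (a \<bullet> \<Gamma>'' t) *\<^sub>R (\<Gamma> t \<times> \<Gamma>' t)"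
  using dual_cramer[of "\<Gamma> t" "\<Gamma>' t" "\<Gamma>'' t" a] assms by (simp add: frame)

text \<open>A nonzero normal vector cannot be orthogonal to all of \<open>\<Gamma> t\<close>,
  \<open>\<Gamma>' t\<close>, \<open>\<Gamma>'' t\<close>, which form a basis; so contact of order
  above 2 never occurs.\<close>

lemma vanishing_order_cases:
  shows "a \<bullet> \<Gamma> t \<noteq> 0 \<Longrightarrow> vanishing_order (\<lambda>s. a \<bullet> \<Gamma> s) t = 0"
    and "a \<bullet> \<Gamma> t = 0 \<Longrightarrow> a \<bullet> \<Gamma>' t \<noteq> 0 \<Longrightarrow> vanishing_order (\<lambda>s. a \<bullet> \<Gamma> s) t = 1"
    and "a \<noteq> 0 \<Longrightarrow> a \<bullet> \<Gamma> t = 0 \<Longrightarrow> a \<bullet> \<Gamma>' t = 0 \<Longrightarrow> vanishing_order (\<lambda>s. a \<bullet> \<Gamma> s) t = 2"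
proof -
  assume "a \<bullet> \<Gamma> t \<noteq> 0"
  then show "vanishing_order (\<lambda>s. a \<bullet> \<Gamma> s) t = 0"
    using vanishing_order_eqI[of 0 "\<lambda>s. a \<bullet> \<Gamma> s" t] by (simp add: zero_enat_def)
next
  assume "a \<bullet> \<Gamma> t = 0" "a \<bullet> \<Gamma>' t \<noteq> 0"
  then have "vanishing_order (\<lambda>s. a \<bullet> \<Gamma> s) t = enat (Suc 0)"
    by (intro vanishing_order_eqI) (simp_all only: iterated_deriv less_Suc0 funpow_0 not_False_eq_True)
  then show "vanishing_order (\<lambda>s. a \<bullet> \<Gamma> s) t = 1" by (simp add: one_enat_def)
next
  assume a: "a \<noteq> 0" "a \<bullet> \<Gamma> t = 0" "a \<bullet> \<Gamma>' t = 0"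
  then have "a \<bullet> \<Gamma>'' t \<noteq> 0" using tangent_line[of a t] by auto
  moreover have "k = 0 \<or> k = Suc 0" if "k < Suc (Suc 0)" for k :: nat using that by auto
  ultimately have "vanishing_order (\<lambda>s. a \<bullet> \<Gamma> s) t = enat (Suc (Suc 0))"
    using a(2,3) by (intro vanishing_order_eqI) (force simp only: iterated_deriv funpow_0)+
  then show "vanishing_order (\<lambda>s. a \<bullet> \<Gamma> s) t = 2" by (simp add: numeral_eq_enat numeral_2_eq_2)
qed

lemma lift_F_has_derivs:
  "((\<lambda>s. lift_F \<Gamma> s y) has_real_derivative \<Gamma>' x \<bullet> (\<Gamma> y \<times> \<Gamma>' y)) (at x)"
  by (simp only: lift_F_eq lift_F_x)

text \<open>At the diagonal the first \<open>x\<close>-derivative is 0 and the second is 1. So the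
  first derivative is positive just to the right, and the mean value theorem passes this on to
  \<open>F\<close>.\<close>

lemma lift_F_pos_near_diagonal: "\<exists>d>0. \<forall>s. y < s \<and> s < y + d \<longrightarrow> lift_F \<Gamma> s y > 0"
proof -
  let ?v = "\<Gamma> y \<times> \<Gamma>' y"
  have "((\<lambda>s. \<Gamma>' s \<bullet> ?v) has_real_derivative 1) (at y)"
    using lift_F_x(2)[of ?v y] by (simp add: frame_rotated)
  from DERIV_pos_inc_right[OF this] obtain d where d: "d > 0"
    "\<And>h. h > 0 \<Longrightarrow> h < d \<Longrightarrow> \<Gamma>' (y + h) \<bullet> ?v > 0"
    by (auto simp: dot_cross_self)
  have "lift_F \<Gamma> s y > 0" if s: "y < s" "s < y + d" for s
  proof -
    have "\<exists>z. y < z \<and> z < s \<and> lift_F \<Gamma> s y - lift_F \<Gamma> y y = (s - y) * (\<Gamma>' z \<bullet> ?v)"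
      by (rule MVT2[OF s(1)]) (rule lift_F_has_derivs)
    then obtain z where z: "y < z" "z < s" "lift_F \<Gamma> s y - lift_F \<Gamma> y y = (s - y) * (\<Gamma>' z \<bullet> ?v)"
      by blast
    have "\<Gamma>' z \<bullet> ?v > 0" using d(2)[of "z - y"] z s by simp
    then show ?thesis using z s by (simp add: lift_F_eq dot_cross_self)
  qed
  then show ?thesis using d(1) by blast
qed

lemma lift_F_pos_if_nonzero:
  assumes nz: "\<And>s. y < s \<Longrightarrow> s < y + T \<Longrightarrow> lift_F \<Gamma> s y \<noteq> 0" and s: "y < s" "s < y + T"
  shows "lift_F \<Gamma> s y > 0"
proof (rule ccontr)
  assume neg: "\<not> lift_F \<Gamma> s y > 0"
  obtain d where d: "d > 0" "\<And>s. y < s \<Longrightarrow> s < y + d \<Longrightarrow> lift_F \<Gamma> s y > 0"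
    using lift_F_pos_near_diagonal by blast
  \<comment> \<open>A point near enough to \<open>y\<close> for positivity and still before
    \<open>s\<close>, from which a sign change up to \<open>s\<close> would produce a zero.\<close>
  define r where "r = (y + min s (y + d)) / 2"
  have r: "y < r" "r < y + d" "r < s" using d(1) s by (auto simp: r_def min_def)
  have "\<exists>z. r \<le> z \<and> z \<le> s \<and> lift_F \<Gamma> z y = 0"
    by (rule IVT2) (use r d(2)[OF r(1,2)] neg in \<open>auto intro!: DERIV_isCont[OF lift_F_has_derivs]\<close>)
  then obtain z where "r \<le> z" "z \<le> s" "lift_F \<Gamma> z y = 0" by blast
  then show False using nz[of z] r s by auto
qed

section \<open>Equivalence of positivity and convexity\<close>

definition positive_lift :: bool where
  "positive_lift \<longleftrightarrow> (\<forall>y s. y < s \<and> s < y + T \<longrightarrow> lift_F \<Gamma> s y > 0)"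

text \<open>Adding a period to the first argument exchanges the order of the two parameters, so
  positivity of \<open>G\<close> already gives that of \<open>F\<close>.\<close>

lemma positive_frieze_iff: "positive_frieze T (lift_F \<Gamma>, \<lambda>x y. lift_F \<Gamma> y x) \<longleftrightarrow> positive_lift"
proof
  assume "positive_frieze T (lift_F \<Gamma>, \<lambda>x y. lift_F \<Gamma> y x)"
  then show positive_lift by (auto simp: positive_frieze_def positive_lift_def)
next
  assume p: positive_lift
  have "lift_F \<Gamma> x y > 0" if "x < y" "y < x + T" for x y
    using p[unfolded positive_lift_def, rule_format, of y "x + T"] that by (simp add: lift_F_periodic)
  then show "positive_frieze T (lift_F \<Gamma>, \<lambda>x y. lift_F \<Gamma> y x)"
    using p by (auto simp: positive_frieze_def positive_lift_def)
qed

definition convex_lift :: bool where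
  "convex_lift \<longleftrightarrow> (\<forall>a. a \<noteq> 0 \<longrightarrow> (\<forall>S. finite S \<and> S \<subseteq> {0..<T} \<longrightarrow>
     (\<Sum>t\<in>S. vanishing_order (\<lambda>s. a \<bullet> \<Gamma> s) t) \<le> 2))"

text \<open>The line \<open>\<Gamma>\<^sup>*(y)\<close> is tangent to the curve at \<open>y\<close>, so that it can have no further intersection.\<close>

lemma convex_imp_positive:
  assumes T: "T > 0" and c: convex_lift
  shows positive_lift
  unfolding positive_lift_def
proof (intro allI impI)
  fix y s assume ys: "y < s \<and> s < y + T"
  have "lift_F \<Gamma> s y \<noteq> 0" if s: "y < s" "s < y + T" for s
  proof
    assume 0: "lift_F \<Gamma> s y = 0"
    obtain k l :: int where k: "s + of_int k * T \<in> {0..<T}" and l: "y + of_int l * T \<in> {0..<T}"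
      using ex_int_shift[OF T] by blast
    define s0 y0 where "s0 = s + of_int k * T" and "y0 = y + of_int l * T"
    have "lift_F \<Gamma> s0 y0 = lift_F \<Gamma> s y"
      using periodic_int[of "\<lambda>x. lift_F \<Gamma> x y0" T s k] periodic_int[of "\<lambda>y. lift_F \<Gamma> s y" T y l]
      by (simp add: lift_F_periodic s0_def y0_def)
    then have z: "lift_F \<Gamma> s0 y0 = 0" using 0 by simp
    \<comment> \<open>The difference \<open>s - y\<close> lies strictly between 0 and
      \<open>T\<close>, so it is no multiple of \<open>T\<close>.\<close>
    have ne: "s0 \<noteq> y0"
    proof
      assume "s0 = y0"
      then have e: "s - y = of_int (l - k) * T" by (simp add: s0_def y0_def algebra_simps)
      then have i: "0 < of_int (l - k) * T" "of_int (l - k) * T < T" using s by linarith+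
      have "0 < (of_int (l - k) :: real)" using i(1) T by (simp only: zero_less_mult_pos2)
      moreover have "(of_int (l - k) :: real) < 1"
        using i(2) mult_less_cancel_right_pos[OF T, of "of_int (l - k)" 1] by simp
      ultimately have "0 < l - k" "l - k < 1" by (simp_all only: of_int_0_less_iff of_int_less_1_iff)
      then show False by linarith
    qed
    let ?a = "\<Gamma> y0 \<times> \<Gamma>' y0"
    have a: "?a \<noteq> 0" using frame_rotated(1)[of y0] by auto
    let ?o = "vanishing_order (\<lambda>s. ?a \<bullet> \<Gamma> s)"
    have "?o y0 = 2"
      by (rule vanishing_order_cases(3)[OF a]) (simp_all add: dot_cross_self)
    moreover have "?o s0 \<ge> 1"
    proof -
      have "?a \<bullet> \<Gamma> s0 = 0" using z by (simp add: lift_F_eq inner_commute)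
      then show ?thesis
        using vanishing_order_cases(2,3)[of ?a s0] a
        by (cases "?a \<bullet> \<Gamma>' s0 = 0") simp_all
    qed
    moreover have "(\<Sum>t\<in>{s0, y0}. ?o t) \<le> 2"
      using c[unfolded convex_lift_def, rule_format, OF a, of "{s0, y0}"] k l by (simp add: s0_def y0_def)
    \<comment> \<open>Tangency at \<open>y0\<close> counts twice and the point \<open>s0\<close> at
      least once.\<close>
    ultimately have "1 + (2::enat) \<le> 2" using ne by (auto intro: order_trans add_right_mono)
    then show False by (simp add: numeral_eq_enat one_enat_def)
  qed
  then show "lift_F \<Gamma> s y > 0" using lift_F_pos_if_nonzero ys by blast
qed

text \<open>Rolle's theorem for the projection of the curve from its point \<open>\<Gamma> x\<close>: the function
  \<open>\<psi>\<close> below is an affine coordinate on the pencil of lines through \<open>\<Gamma> x\<close>.\<close>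

lemma positive_imp_not_collinear:
  assumes p: positive_lift and x: "x < y" "y < z" "z < x + T"
  shows "\<Gamma> x \<bullet> (\<Gamma> y \<times> \<Gamma> z) \<noteq> 0"
proof
  assume 0: "\<Gamma> x \<bullet> (\<Gamma> y \<times> \<Gamma> z) = 0"
  let ?w = "\<Gamma> x \<times> \<Gamma>' x" and ?u = "\<Gamma> x \<times> \<Gamma> y"
  define \<psi> where "\<psi> s = (\<Gamma> s \<bullet> ?u) / (\<Gamma> s \<bullet> ?w)" for s
  have pos: "\<Gamma> s \<bullet> ?w > 0" if "x < s" "s < x + T" for s
    using p that by (auto simp: positive_lift_def lift_F_eq)
  have d: "(\<psi> has_real_derivative
      ((\<Gamma>' s \<bullet> ?u) * (\<Gamma> s \<bullet> ?w) - (\<Gamma> s \<bullet> ?u) * (\<Gamma>' s \<bullet> ?w)) / ((\<Gamma> s \<bullet> ?w) * (\<Gamma> s \<bullet> ?w))) (at s)"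
    if "y \<le> s" "s \<le> z" for s
    unfolding \<psi>_def[abs_def] by (intro DERIV_divide lift_F_x) (use pos[of s] that x in auto)
  \<comment> \<open>Collinearity places \<open>\<Gamma> z\<close> on the line through
    \<open>\<Gamma> x\<close> and \<open>\<Gamma> y\<close>, so \<open>\<psi>\<close> vanishes at
    both ends.\<close>
  have "\<Gamma> z \<bullet> ?u = 0" using 0 by (metis triple_rotate(2))
  then have "\<psi> y = \<psi> z" by (simp add: \<psi>_def dot_cross_self)
  moreover have "continuous_on {y..z} \<psi>"
    by (rule DERIV_continuous_on) (use d in \<open>auto intro: has_field_derivative_at_within\<close>)
  moreover have "\<psi> differentiable (at s)" if "y < s" "s < z" for s
    using d[of s] that real_differentiable_def by auto
  ultimately obtain s where s: "y < s" "s < z" "(\<psi> has_real_derivative 0) (at s)"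
    using Rolle[of y z \<psi>] x(2) by blast
  have ne: "\<Gamma> s \<bullet> ?w > 0" using pos[of s] s x by auto
  have "((\<Gamma>' s \<bullet> ?u) * (\<Gamma> s \<bullet> ?w) - (\<Gamma> s \<bullet> ?u) * (\<Gamma>' s \<bullet> ?w)) / ((\<Gamma> s \<bullet> ?w) * (\<Gamma> s \<bullet> ?w)) = 0"
    using DERIV_unique[OF d[of s] s(3)] s by simp
  then have "(\<Gamma>' s \<bullet> ?u) * (\<Gamma> s \<bullet> ?w) - (\<Gamma> s \<bullet> ?u) * (\<Gamma>' s \<bullet> ?w) = 0" using ne by simp
  moreover have "(\<Gamma>' s \<bullet> ?u) * (\<Gamma> s \<bullet> ?w) - (\<Gamma> s \<bullet> ?u) * (\<Gamma>' s \<bullet> ?w) = (\<Gamma> s \<times> \<Gamma>' s) \<bullet> (?w \<times> ?u)"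
    by (simp add: dot_cross mult.commute)
  \<comment> \<open>The numerator of the derivative factors into \<open>F\<close> at (y, x) and
    \<open>F\<close> at (x, s). Both are positive, the second after shifting \<open>x\<close> by a
    period.\<close>
  moreover have "(\<Gamma> s \<times> \<Gamma>' s) \<bullet> (?w \<times> ?u) = (\<Gamma> y \<bullet> ?w) * (\<Gamma> x \<bullet> (\<Gamma> s \<times> \<Gamma>' s))"
    by (simp add: cross_cross_common inner_commute[of "\<Gamma> s \<times> \<Gamma>' s"] triple_rotate(2)[of "\<Gamma> x" "\<Gamma>' x" "\<Gamma> y"])
  moreover have "\<Gamma> y \<bullet> ?w > 0" using pos[of y] x by auto
  moreover have "lift_F \<Gamma> (x + T) s > 0"
    using p s x unfolding positive_lift_def by auto
  then have "\<Gamma> x \<bullet> (\<Gamma> s \<times> \<Gamma>' s) > 0" by (simp add: lift_F_periodic) (simp add: lift_F_eq)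
  ultimately show False by simp
qed

text \<open>If the line is tangent at \<open>t\<close>, its normal is a multiple of the dual curve
  at \<open>t\<close>, and positivity excludes other intersections. Otherwise every intersection is
  simple, and three of them would be collinear points.\<close>

lemma positive_imp_convex:
  assumes p: positive_lift
  shows convex_lift
  unfolding convex_lift_def
proof (intro allI impI)
  fix a :: "real^3" and S assume a: "a \<noteq> 0" and S: "finite S \<and> S \<subseteq> {0..<T}"
  let ?o = "vanishing_order (\<lambda>s. a \<bullet> \<Gamma> s)"
  define Z where "Z = {t\<in>S. a \<bullet> \<Gamma> t = 0}"
  have Z: "finite Z" "Z \<subseteq> S" using S by (auto simp: Z_def)
  have sum: "(\<Sum>t\<in>S. ?o t) = (\<Sum>t\<in>Z. ?o t)"
    using S by (intro sum.mono_neutral_right) (auto simp: Z_def vanishing_order_cases(1))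
  show "(\<Sum>t\<in>S. ?o t) \<le> 2"
  proof (cases "\<exists>t\<in>Z. a \<bullet> \<Gamma>' t = 0")
    case True
    then obtain t where t: "t \<in> Z" "a \<bullet> \<Gamma> t = 0" "a \<bullet> \<Gamma>' t = 0" by (auto simp: Z_def)
    have "s = t" if s: "s \<in> Z" for s
    proof (rule ccontr)
      assume "s \<noteq> t"
      have r: "0 \<le> s" "s < T" "0 \<le> t" "t < T" using s t(1) Z(2) S by auto
      have "a \<bullet> \<Gamma> s = (a \<bullet> \<Gamma>'' t) * lift_F \<Gamma> s t"
        by (subst tangent_line[OF t(2,3)]) (simp add: lift_F_eq inner_commute)
      moreover have "a \<bullet> \<Gamma>'' t \<noteq> 0" using tangent_line[OF t(2,3)] a by auto
      moreover have "lift_F \<Gamma> s t > 0"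
      proof (cases "t < s")
        case True
        then show ?thesis using p r unfolding positive_lift_def by auto
      next
        case False
        then have "lift_F \<Gamma> (s + T) t > 0"
          using p r \<open>s \<noteq> t\<close> unfolding positive_lift_def by auto
        then show ?thesis by (simp add: lift_F_periodic)
      qed
      ultimately show False using s by (simp add: Z_def)
    qed
    with t(1) have "Z = {t}" by blast
    then have "(\<Sum>t\<in>Z. ?o t) = ?o t" by simp
    then show ?thesis unfolding sum vanishing_order_cases(3)[OF a t(2,3)] by simp
  next
    case False
    then have "?o t = 1" if "t \<in> Z" for t
      using that vanishing_order_cases(2) by (auto simp: Z_def)
    then have "(\<Sum>t\<in>Z. ?o t) = of_nat (card Z)" by simp
    moreover have "card Z \<le> 2"
    proof (rule ccontr)
      assume c: "\<not> card Z \<le> 2"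
      then have Z0: "Z \<noteq> {}" by auto
      have "card {Min Z, Max Z} \<le> 2" by (simp add: card_insert_if)
      \<comment> \<open>More than two intersections leave one strictly between the first and the
        last.\<close>
      then have "\<not> Z \<subseteq> {Min Z, Max Z}"
        using c card_mono[of "{Min Z, Max Z}" Z] by auto
      then obtain y where y: "y \<in> Z" "y \<noteq> Min Z" "y \<noteq> Max Z" by auto
      have m: "Min Z \<in> Z" "Max Z \<in> Z" using Z(1) Z0 by simp_all
      have "Min Z < y" "y < Max Z"
        using Min_le[OF Z(1) y(1)] Max_ge[OF Z(1) y(1)] y(2,3) by auto
      moreover have "Max Z < Min Z + T"
      proof -
        have "0 \<le> Min Z" "Max Z < T" using m Z(2) S by auto
        then show ?thesis by linarith
      qed
      ultimately have "\<Gamma> (Min Z) \<bullet> (\<Gamma> y \<times> \<Gamma> (Max Z)) \<noteq> 0"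
        by (rule positive_imp_not_collinear[OF p])
      \<comment> \<open>All three coefficients in the dual expansion of \<open>a\<close> vanish,
        since the points lie on the line.\<close>
      moreover have "(\<Gamma> (Min Z) \<bullet> (\<Gamma> y \<times> \<Gamma> (Max Z))) *\<^sub>R a = 0"
        using m y(1) by (subst dual_cramer) (simp add: Z_def)
      ultimately show False using a by simp
    qed
    ultimately show ?thesis by (simp add: sum of_nat_eq_enat numeral_eq_enat)
  qed
qed

end

section \<open>The correspondence between classes of curves and friezes\<close>

lemma positive_frieze_iff_convex_curve:
  assumes "T > 0" "\<gamma> \<in> closed_projective_curves T"
  shows "positive_frieze T (curve_F \<gamma>, curve_G \<gamma>) \<longleftrightarrow> convex_curve T \<gamma>"
proof -
  interpret unimodular_curve "normalized_lift \<gamma>" T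
    by (rule unimodular_curve_normalized_lift[OF assms(2)])
  have "curve_G \<gamma> = (\<lambda>x y. lift_F (normalized_lift \<gamma>) y x)"
    by (intro ext) (simp add: curve_G_def curve_F_eq_lift_F)
  moreover have "convex_curve T \<gamma> \<longleftrightarrow> convex_lift"
    by (simp add: convex_curve_def convex_lift_def intersection_multiplicity_def)
  ultimately show ?thesis
    using positive_frieze_iff convex_imp_positive[OF assms(1)] positive_imp_convex
    by (auto simp: curve_F_eq_lift_F)
qed

theorem theorem4p7:
  fixes T :: real
  assumes "T > 0"
  shows "\<exists>\<Phi>. bij_betw \<Phi> (closed_projective_curves T // sl3_equiv T) (closed_friezes T) \<and>
    (\<forall>\<gamma>\<in>closed_projective_curves T. \<Phi> (sl3_equiv T `` {\<gamma>}) = (curve_F \<gamma>, curve_G \<gamma>)) \<and>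
    (\<forall>C\<in>closed_projective_curves T // sl3_equiv T. \<forall>\<gamma>\<in>C.
       positive_frieze T (\<Phi> C) \<longleftrightarrow> convex_curve T \<gamma>)"
proof -
  let ?X = "closed_projective_curves T" and ?R = "sl3_equiv T"
  \<comment> \<open>The chosen representative does not matter, because equivalent curves have the
    same \<open>F\<close>, which determines \<open>G\<close>.\<close>
  define \<Phi> where "\<Phi> C = (let \<gamma> = SOME \<gamma>. \<gamma> \<in> C in (curve_F \<gamma>, curve_G \<gamma>))" for C
  have G: "curve_G \<gamma> = (\<lambda>x y. curve_F \<gamma> y x)" for \<gamma> by (intro ext) (simp add: curve_G_def)
  have \<Phi>: "\<Phi> (?R `` {\<gamma>}) = (curve_F \<gamma>, curve_G \<gamma>)" if "\<gamma> \<in> ?X" for \<gamma>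
  proof -
    have "\<gamma> \<in> ?R `` {\<gamma>}" by (rule equiv_class_self[OF equiv_sl3_equiv that])
    then have "(SOME \<delta>. \<delta> \<in> ?R `` {\<gamma>}) \<in> ?R `` {\<gamma>}" by (rule someI[of "\<lambda>\<delta>. \<delta> \<in> ?R `` {\<gamma>}"])
    then have "curve_F \<gamma> = curve_F (SOME \<delta>. \<delta> \<in> ?R `` {\<gamma>})"
      by (intro sl3_equiv_imp_curve_F_eq[of _ _ T]) blast
    then show ?thesis by (simp add: \<Phi>_def Let_def G)
  qed
  have "bij_betw \<Phi> (?X // ?R) (closed_friezes T)"
    unfolding bij_betw_def
  proof
    show "inj_on \<Phi> (?X // ?R)"
    proof (rule inj_onI)
      fix C D assume CD: "C \<in> ?X // ?R" "D \<in> ?X // ?R" "\<Phi> C = \<Phi> D"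
      obtain \<gamma> where \<gamma>: "\<gamma> \<in> ?X" "C = ?R `` {\<gamma>}" using CD(1) by (rule quotientE)
      obtain \<delta> where \<delta>: "\<delta> \<in> ?X" "D = ?R `` {\<delta>}" using CD(2) by (rule quotientE)
      have "curve_F \<gamma> = curve_F \<delta>" using CD(3) \<gamma> \<delta> by (simp add: \<Phi>)
      then show "C = D"
        using curve_F_eq_imp_sl3_equiv[OF \<gamma>(1) \<delta>(1)] equiv_class_eq[OF equiv_sl3_equiv] \<gamma>(2) \<delta>(2)
        by blast
    qed
    have "(curve_F \<gamma>, curve_G \<gamma>) \<in> closed_friezes T" if "\<gamma> \<in> ?X" for \<gamma>
      using unimodular_curve.lift_F_frieze[OF unimodular_curve_normalized_lift[OF that]]
      by (simp add: G curve_F_eq_lift_F)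
    moreover have "P \<in> \<Phi> ` (?X // ?R)" if P: "P \<in> closed_friezes T" for P
    proof -
      interpret frieze "fst P" "snd P" T by unfold_locales (simp add: P)
      obtain \<gamma> where "\<gamma> \<in> ?X" "curve_F \<gamma> = fst P" "curve_G \<gamma> = snd P" using ex_curve by blast
      then have "P = \<Phi> (?R `` {\<gamma>})" "?R `` {\<gamma>} \<in> ?X // ?R"
        by (simp_all add: \<Phi> quotientI)
      then show ?thesis by (rule image_eqI)
    qed
    ultimately show "\<Phi> ` (?X // ?R) = closed_friezes T"
      using \<Phi> by (auto elim!: quotientE)
  qed
  moreover have "positive_frieze T (\<Phi> C) \<longleftrightarrow> convex_curve T \<gamma>" if C: "C \<in> ?X // ?R" "\<gamma> \<in> C" for C \<gamma>
  proof -
    have \<gamma>: "\<gamma> \<in> ?X" using C in_quotient_imp_subset[OF equiv_sl3_equiv] by blast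
    obtain \<delta> where \<delta>: "C = ?R `` {\<delta>}" using C(1) by (rule quotientE)
    then have "(\<delta>, \<gamma>) \<in> ?R" using C(2) by simp
    then have "C = ?R `` {\<gamma>}" unfolding \<delta> by (rule equiv_class_eq[OF equiv_sl3_equiv])
    then show ?thesis using positive_frieze_iff_convex_curve[OF assms \<gamma>] \<Phi>[OF \<gamma>] by simp
  qed
  ultimately show ?thesis using \<Phi> by blast
qed

end
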